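(* Let $d\in\mathbb{N}$, let $\mu$ be a $\sigma$-finite measure on $\mathbb{R}$, and let $\Psi:=\{\psi_v:\ v\in[0,1]\}\subset L_2(\mu)$ be a collection of functions with $L_2(\mu)$-norm at most $1$ such that, for some constant $V>0$, $$N(\epsilon,\Psi)\lesssim\epsilon^{-V}.$$ Let $q\in\mathbb{N}$, $\gamma>0$, $W>0$ and suppose $\{\mathcal{V}_k\}_{k\in\mathbb{N}_0}$ is a nested sequence of approximations of $\Psi$ with parameters $(q,\gamma,W)$. Then, with $$\mathcal{F}:=\mathrm{absconv}(\underbrace{\Psi\otimes\cdots\otimes\Psi}_{d\ \text{times}})\subset L_2(\underbrace{\mu\times\cdots\times\mu}_{d\ \text{times}}),$$ we have $$\mathcal{H}(\epsilon,\mathcal{F})\lesssim\epsilon^{-\frac{2W}{2+W}}\,\log^{d-1}(1/\epsilon)\,\log^{\frac{W}{2+W}}(1/\epsilon).$$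
   Context: For functions $g,h$ of $\epsilon\in(0,1]$, $h(\epsilon)\lesssim g(\epsilon)$ means $\limsup_{\epsilon\downarrow0}h(\epsilon)/g(\epsilon)<\infty$. For a subset $T$ of a metric space, $N(\epsilon,T)$ is the minimum number of balls of radius $\epsilon$ needed to cover $T$, and $\mathcal{H}(\epsilon,T):=\log N(\epsilon,T)$. $N(\epsilon,\Psi)$ is with respect to the $L_2(\mu)$-norm and $\mathcal{H}(\epsilon,\mathcal{F})$ with respect to the $L_2(\mu\times\cdots\times\mu)$-norm. $\mathrm{absconv}(\Psi\otimes\cdots\otimes\Psi)$ is the closure (in $L_2(\mu\times\cdots\times\mu)$) of the set of all functions $$(u_1,\ldots,u_d)\mapsto\sum_{v_1\in V_1}\cdots\sum_{v_d\in V_d}\beta_{v_1,\ldots,v_d}\,\psi_{v_1}(u_1)\cdots\psi_{v_d}(u_d),$$ where $V_1,\ldots,V_d$ are finite subsets of $[0,1]$ and the $\beta_{v_1,\ldots,v_d}\in\mathbb{R}$ satisfy $\sum|\beta_{v_1,\ldots,v_d}|\le1$. A nested sequence of approximations of $\Psi$ with parameters $(q,\gamma,W)$ is a sequence of linear subspaces $\mathcal{V}_0\subset\mathcal{V}_1\subset\cdots$ of $L_2(\mu)$ with $\dim(\mathcal{V}_k)=q2^k$ for $k\in\mathbb{N}_0$, such that for all $k\in\mathbb{N}=\{1,2,\ldots\}$, $$\sup_{v\in[0,1]}\min_{f\in\mathcal{V}_k}\int(\psi_v-f)^2\,d\mu\le\gamma^2 2^{-2k/W}.$$ *)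

theory Defs
  imports "HOL-Analysis.Analysis"
begin

text \<open>
  Elements of $L_2(M)$ are represented by square-integrable functions, and the $L_2$-norm is the
  corresponding seminorm. Covering numbers and closures are insensitive to the identification of
  functions that agree almost everywhere. Subspaces and dimensions are sensitive to it, so there
  it is built into the definitions.
\<close>

definition L2_fun :: "'a measure \<Rightarrow> ('a \<Rightarrow> real) set" where
  "L2_fun M = {f \<in> borel_measurable M. integrable M (\<lambda>x. (f x)\<^sup>2)}"

definition L2_seminorm :: "'a measure \<Rightarrow> ('a \<Rightarrow> real) \<Rightarrow> real" where
  "L2_seminorm M f = sqrt (\<integral>x. (f x)\<^sup>2 \<partial>M)"

definition L2_dist :: "'a measure \<Rightarrow> ('a \<Rightarrow> real) \<Rightarrow> ('a \<Rightarrow> real) \<Rightarrow> real" where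
  "L2_dist M f g = L2_seminorm M (\<lambda>x. f x - g x)"

definition L2_closure :: "'a measure \<Rightarrow> ('a \<Rightarrow> real) set \<Rightarrow> ('a \<Rightarrow> real) set" where
  "L2_closure M A = {f \<in> L2_fun M. \<forall>e>0. \<exists>g\<in>A. L2_dist M f g < e}"

text \<open>
  Closedness under almost-everywhere equality makes these sets correspond exactly to the linear
  subspaces of the quotient space $L_2(M)$.
\<close>

definition L2_subspace :: "'a measure \<Rightarrow> ('a \<Rightarrow> real) set \<Rightarrow> bool" where
  "L2_subspace M S \<longleftrightarrow>
     S \<subseteq> L2_fun M \<and>
     (\<lambda>x. 0) \<in> S \<and>
     (\<forall>f\<in>S. \<forall>g\<in>S. (\<lambda>x. f x + g x) \<in> S) \<and>
     (\<forall>c. \<forall>f\<in>S. (\<lambda>x. c * f x) \<in> S) \<and>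
     (\<forall>f\<in>S. \<forall>g\<in>borel_measurable M. (AE x in M. f x = g x) \<longrightarrow> g \<in> S)"

text \<open>
  The dimension is that of the quotient by the null functions: \<open>b 0, \<dots>, b (n - 1)\<close> is a basis
  modulo almost-everywhere equality.
\<close>

definition L2_has_dim :: "'a measure \<Rightarrow> ('a \<Rightarrow> real) set \<Rightarrow> nat \<Rightarrow> bool" where
  "L2_has_dim M S n \<longleftrightarrow>
     (\<exists>b :: nat \<Rightarrow> 'a \<Rightarrow> real.
        (\<forall>i<n. b i \<in> S) \<and>
        (\<forall>c. (AE x in M. (\<Sum>i<n. c i * b i x) = 0) \<longrightarrow> (\<forall>i<n. c i = 0)) \<and>
        (\<forall>f\<in>S. \<exists>c. AE x in M. f x = (\<Sum>i<n. c i * b i x)))"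

text \<open>
  Balls are open and their centres range over the whole ambient space \<open>X\<close> with (pseudo-)metric
  \<open>dst\<close>. The value is \<open>\<infinity>\<close> if there is no finite cover. The convention \<open>ln 0 = 0\<close> in the
  entropy is reached only for \<open>T = {}\<close>.
\<close>

definition covering_number ::
  "'a set \<Rightarrow> ('a \<Rightarrow> 'a \<Rightarrow> real) \<Rightarrow> real \<Rightarrow> 'a set \<Rightarrow> enat" where
  "covering_number X dst \<epsilon> T =
     (INF C \<in> {C. finite C \<and> C \<subseteq> X \<and> T \<subseteq> (\<Union>c\<in>C. {x \<in> X. dst c x < \<epsilon>})}. enat (card C))"

definition metric_entropy ::
  "'a set \<Rightarrow> ('a \<Rightarrow> 'a \<Rightarrow> real) \<Rightarrow> real \<Rightarrow> 'a set \<Rightarrow> ereal" where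
  "metric_entropy X dst \<epsilon> T =
     (case covering_number X dst \<epsilon> T of enat n \<Rightarrow> ereal (ln (real n)) | \<infinity> \<Rightarrow> \<infinity>)"

text \<open>The left-hand function may be infinite, since covering numbers may be.\<close>

definition lesssim :: "(real \<Rightarrow> ereal) \<Rightarrow> (real \<Rightarrow> real) \<Rightarrow> bool" where
  "lesssim h g \<longleftrightarrow> Limsup (at_right 0) (\<lambda>\<epsilon>. h \<epsilon> / ereal (g \<epsilon>)) < \<infinity>"

abbreviation product_power :: "'a measure \<Rightarrow> nat \<Rightarrow> (nat \<Rightarrow> 'a) measure" where
  "product_power M d \<equiv> Pi\<^sub>M {..<d} (\<lambda>_. M)"

text \<open>
  The coordinates are numbered \<open>0, \<dots>, d - 1\<close>, and a multi-index is a point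
  of the extensional product of the sets \<open>A i\<close>, the finite subsets $V_1,\dots,V_d$ of $[0,1]$.
\<close>

definition absconv_tensor_combs ::
  "nat \<Rightarrow> (real \<Rightarrow> 'a \<Rightarrow> real) \<Rightarrow> ((nat \<Rightarrow> 'a) \<Rightarrow> real) set" where
  "absconv_tensor_combs d \<psi> =
     {(\<lambda>u. \<Sum>v \<in> Pi\<^sub>E {..<d} A. \<beta> v * (\<Prod>i<d. \<psi> (v i) (u i))) | A \<beta>.
        (\<forall>i<d. finite (A i) \<and> A i \<subseteq> {0..1}) \<and> (\<Sum>v \<in> Pi\<^sub>E {..<d} A. \<bar>\<beta> v\<bar>) \<le> 1}"

definition absconv_tensor ::
  "'a measure \<Rightarrow> nat \<Rightarrow> (real \<Rightarrow> 'a \<Rightarrow> real) \<Rightarrow> ((nat \<Rightarrow> 'a) \<Rightarrow> real) set" where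
  "absconv_tensor M d \<psi> = L2_closure (product_power M d) (absconv_tensor_combs d \<psi>)"

text \<open>
  The inner minimum is written as an infimum; it is attained because \<open>\<V> k\<close> is
  finite-dimensional. Working in \<^typ>\<open>ennreal\<close> ensures that all suprema and infima exist.
\<close>

definition nested_approximations ::
  "'a measure \<Rightarrow> (real \<Rightarrow> 'a \<Rightarrow> real) \<Rightarrow> nat \<Rightarrow> real \<Rightarrow> real \<Rightarrow> (nat \<Rightarrow> ('a \<Rightarrow> real) set) \<Rightarrow> bool" where
  "nested_approximations M \<psi> q \<gamma> W \<V> \<longleftrightarrow>
     (\<forall>k. L2_subspace M (\<V> k)) \<and>
     (\<forall>k. \<V> k \<subseteq> \<V> (Suc k)) \<and>
     (\<forall>k. L2_has_dim M (\<V> k) (q * 2 ^ k)) \<and>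
     (\<forall>k\<ge>1. (SUP v\<in>{0..1}. INF f\<in>\<V> k. \<integral>\<^sup>+x. ennreal ((\<psi> v x - f x)\<^sup>2) \<partial>M)
              \<le> ennreal (\<gamma>\<^sup>2 * 2 powr (- 2 * real k / W)))"

end

theory Submission
  imports Defs
begin

text \<open>
  Let \<open>N(r)\<close> be the number of balls of radius \<open>r\<close> needed to cover the absolutely convex hull.
  The proof compares \<open>N(r / 2)\<close> with \<open>N(r)\<close>. Take a subspace of dimension \<open>D\<close> that approximates
  all generators up to \<open>\<sigma>\<close>, and split every \<open>f\<close> in the hull into its orthogonal projection and
  the residual.

  \<^item> If \<open>f\<close> lies in a ball of radius \<open>r\<close>, then its projection lies in a ball of radius \<open>r\<close> of a
    \<open>D\<close>-dimensional Euclidean space. Such a ball is covered by \<open>exp (O(D))\<close> balls of radius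
    \<open>r / 4\<close> (\<open>lattice_net\<close>), a bound without a factor \<open>log (1 / r)\<close>.
  \<^item> The residual lies in the absolutely convex hull of functions of norm at most \<open>\<sigma>\<close>. The
    generators may be restricted to a net of polynomial size, and by Maurey's argument an average of
    about \<open>(\<sigma> / r)\<^sup>2\<close> of them approximates the residual (\<open>maurey_cover\<close>). This costs
    \<open>O((\<sigma> / r)\<^sup>2 log (1 / r))\<close> in the entropy.

  So \<open>log N(r / 2) \<le> log N(r) + O(D) + O((\<sigma> / r)\<^sup>2 log (1 / r))\<close> (\<open>coverable_halve\<close>).

  The subspaces come from sparse grids. Gram-Schmidt applied to bases of \<open>\<V> 0, \<V> 1, \<dots>\<close>
  gives one orthonormal sequence with about \<open>q 2^j\<close> elements of level \<open>j\<close>. Of the tensor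
  products of its elements keep those whose levels add up to at most \<open>k\<close>. There are
  \<open>D = O(k^(d-1) 2^k)\<close> of them (\<open>card_sparse_le\<close>), and by orthogonality the squared error
  for a product \<open>\<psi> v\<^sub>1 \<otimes> \<dots> \<otimes> \<psi> v\<^sub>d\<close> is the sum over the discarded products, which gives
  \<open>\<sigma>\<^sup>2 = O(k^(d-1) 2^(-2k/W))\<close> (\<open>sparse_tail_le\<close>, \<open>residual_tensor\<close>). Adding
  norms in place of squared norms would double the power of \<open>k\<close>.

  At \<open>r = 2 / 2^n\<close> the two costs balance for \<open>2^k\<close> about \<open>2^(an) n^(a/2)\<close> with
  \<open>a = 2W / (2 + W)\<close>; both are then \<open>O(n^(d-1) n^(a/2) 2^(an))\<close> (\<open>balance_levels\<close>).
  Summing over the scales from \<open>2\<close> down to \<open>2 / 2^n\<close> gives a geometric series dominated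
  by its last term, and this is the claim for \<open>\<epsilon>\<close> of order \<open>2^(-n)\<close>.
\<close>

section \<open>Square-integrable functions as a semi-inner product space\<close>

definition ip :: "'a measure \<Rightarrow> ('a \<Rightarrow> real) \<Rightarrow> ('a \<Rightarrow> real) \<Rightarrow> real" where
  "ip M f g = (\<integral>x. f x * g x \<partial>M)"

lemma L2_fun_mult_integrable:
  assumes "f \<in> L2_fun M" "g \<in> L2_fun M"
  shows "integrable M (\<lambda>x. f x * g x)"
proof (rule Bochner_Integration.integrable_bound)
  show "integrable M (\<lambda>x. (f x)\<^sup>2 + (g x)\<^sup>2)"
    using assms by (auto simp: L2_fun_def)
  show "(\<lambda>x. f x * g x) \<in> borel_measurable M"
    using assms by (auto simp: L2_fun_def)
  have "\<bar>a * b\<bar> \<le> a\<^sup>2 + b\<^sup>2" for a b :: real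
  proof -
    have "2 * \<bar>a\<bar> * \<bar>b\<bar> \<le> \<bar>a\<bar>\<^sup>2 + \<bar>b\<bar>\<^sup>2"
      by (rule sum_squares_bound)
    moreover have "0 \<le> \<bar>a\<bar> * \<bar>b\<bar>" by simp
    ultimately show ?thesis unfolding abs_mult power2_abs by linarith
  qed
  then show "AE x in M. norm (f x * g x) \<le> norm ((f x)\<^sup>2 + (g x)\<^sup>2)"
    by simp
qed

lemma L2_fun_zero [simp]: "(\<lambda>x. 0) \<in> L2_fun M"
  by (simp add: L2_fun_def)

lemma L2_fun_add:
  assumes "f \<in> L2_fun M" "g \<in> L2_fun M"
  shows "(\<lambda>x. f x + g x) \<in> L2_fun M"
proof -
  have "integrable M (\<lambda>x. (f x)\<^sup>2 + (g x)\<^sup>2 + 2 * (f x * g x))"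
    using assms L2_fun_mult_integrable[OF assms] by (auto simp: L2_fun_def)
  then show ?thesis
    using assms by (auto simp: L2_fun_def power2_sum mult.assoc)
qed

lemma L2_fun_scale: "f \<in> L2_fun M \<Longrightarrow> (\<lambda>x. c * f x) \<in> L2_fun M"
  by (auto simp: L2_fun_def power_mult_distrib)

lemma L2_fun_diff: "f \<in> L2_fun M \<Longrightarrow> g \<in> L2_fun M \<Longrightarrow> (\<lambda>x. f x - g x) \<in> L2_fun M"
  using L2_fun_add[of f M "\<lambda>x. (-1) * g x"] L2_fun_scale[of g M "-1"] by simp

lemma L2_fun_sum:
  "(\<And>i. i \<in> I \<Longrightarrow> f i \<in> L2_fun M) \<Longrightarrow> (\<lambda>x. \<Sum>i\<in>I. c i * f i x) \<in> L2_fun M"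
proof (induction I rule: infinite_finite_induct)
  case (insert i I)
  then show ?case
    by (simp add: L2_fun_add L2_fun_scale)
qed auto

lemma L2_fun_divide: "f \<in> L2_fun M \<Longrightarrow> (\<lambda>x. f x / c) \<in> L2_fun M"
  using L2_fun_scale[of f M "inverse c"] by (simp add: field_simps)

lemma ip_commute: "ip M f g = ip M g f"
  by (simp add: ip_def mult.commute)

lemma ip_self_nonneg: "0 \<le> ip M f f"
  by (simp add: ip_def)

lemma ip_add:
  "f \<in> L2_fun M \<Longrightarrow> g \<in> L2_fun M \<Longrightarrow> h \<in> L2_fun M \<Longrightarrow>
   ip M (\<lambda>x. f x + g x) h = ip M f h + ip M g h"
  by (simp add: ip_def distrib_right L2_fun_mult_integrable)

lemma ip_diff:
  "f \<in> L2_fun M \<Longrightarrow> g \<in> L2_fun M \<Longrightarrow> h \<in> L2_fun M \<Longrightarrow>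
   ip M (\<lambda>x. f x - g x) h = ip M f h - ip M g h"
  by (simp add: ip_def left_diff_distrib L2_fun_mult_integrable)

lemma ip_scale: "ip M (\<lambda>x. c * f x) g = c * ip M f g"
  by (simp add: ip_def mult.assoc)

lemma ip_sum:
  "(\<And>i. i \<in> I \<Longrightarrow> f i \<in> L2_fun M) \<Longrightarrow> h \<in> L2_fun M \<Longrightarrow>
   ip M (\<lambda>x. \<Sum>i\<in>I. c i * f i x) h = (\<Sum>i\<in>I. c i * ip M (f i) h)"
proof (induction I rule: infinite_finite_induct)
  case (insert i I)
  then show ?case
    by (simp add: ip_add L2_fun_scale L2_fun_sum ip_scale)
qed (auto simp: ip_def)

lemma ip_add_right:
  "f \<in> L2_fun M \<Longrightarrow> g \<in> L2_fun M \<Longrightarrow> h \<in> L2_fun M \<Longrightarrow>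
   ip M h (\<lambda>x. f x + g x) = ip M h f + ip M h g"
  using ip_add[of f M g h] by (simp only: ip_commute)

lemma ip_diff_right:
  "f \<in> L2_fun M \<Longrightarrow> g \<in> L2_fun M \<Longrightarrow> h \<in> L2_fun M \<Longrightarrow>
   ip M h (\<lambda>x. f x - g x) = ip M h f - ip M h g"
  using ip_diff[of f M g h] by (simp only: ip_commute)

lemma ip_scale_right: "ip M g (\<lambda>x. c * f x) = c * ip M g f"
  using ip_scale[of M c f g] by (simp only: ip_commute)

lemma ip_sum_right:
  "(\<And>i. i \<in> I \<Longrightarrow> f i \<in> L2_fun M) \<Longrightarrow> h \<in> L2_fun M \<Longrightarrow>
   ip M h (\<lambda>x. \<Sum>i\<in>I. c i * f i x) = (\<Sum>i\<in>I. c i * ip M h (f i))"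
  using ip_sum[of I f M h c] by (simp only: ip_commute)

lemma ip_divide: "ip M (\<lambda>x. f x / c) g = ip M f g / c"
  using ip_scale[of M "inverse c" f g] by (simp add: field_simps)

lemma ip_divide_right: "ip M g (\<lambda>x. f x / c) = ip M g f / c"
  using ip_divide[of M f c g] by (simp only: ip_commute)

lemma L2_seminorm_eq_ip: "L2_seminorm M f = sqrt (ip M f f)"
  by (simp add: L2_seminorm_def ip_def power2_eq_square)

lemma L2_seminorm_sq: "(L2_seminorm M f)\<^sup>2 = ip M f f"
  by (simp add: L2_seminorm_eq_ip ip_self_nonneg)

lemma L2_seminorm_nonneg [simp]: "0 \<le> L2_seminorm M f"
  by (simp add: L2_seminorm_eq_ip ip_self_nonneg)

lemma ip_add_self:
  assumes "f \<in> L2_fun M" "g \<in> L2_fun M"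
  shows "ip M (\<lambda>x. f x + g x) (\<lambda>x. f x + g x) = ip M f f + 2 * ip M f g + ip M g g"
  using assms by (simp add: ip_add ip_add_right L2_fun_add ip_commute[of M g f])

lemma ip_diff_self:
  assumes "f \<in> L2_fun M" "g \<in> L2_fun M"
  shows "ip M (\<lambda>x. f x - g x) (\<lambda>x. f x - g x) = ip M f f - 2 * ip M f g + ip M g g"
  using assms by (simp add: ip_diff ip_diff_right L2_fun_diff ip_commute[of M g f])

text \<open>
  The discriminant argument. The seminorm may vanish on a nonzero \<open>g\<close>, and then the quadratic
  polynomial is affine and can be nonnegative only with slope zero.
\<close>

lemma ip_Cauchy_Schwarz:
  assumes f: "f \<in> L2_fun M" and g: "g \<in> L2_fun M"
  shows "\<bar>ip M f g\<bar> \<le> L2_seminorm M f * L2_seminorm M g"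
proof -
  have quad: "0 \<le> ip M f f + 2 * t * ip M f g + t\<^sup>2 * ip M g g" for t
    using ip_add_self[OF f L2_fun_scale[OF g, of t]] ip_self_nonneg[of M "\<lambda>x. f x + t * g x"]
    by (simp add: ip_scale ip_scale_right power2_eq_square algebra_simps)
  have "(ip M f g)\<^sup>2 \<le> ip M f f * ip M g g"
  proof (cases "ip M g g = 0")
    case True
    have "ip M f g = 0"
    proof (rule ccontr)
      assume "ip M f g \<noteq> 0"
      then show False
        using quad[of "- (ip M f f + 1) / (2 * ip M f g)"] True by (simp add: field_simps)
    qed
    then show ?thesis using True by simp
  next
    case False
    then have "ip M g g > 0" using ip_self_nonneg[of M g] by linarith
    then show ?thesis
      using quad[of "- ip M f g / ip M g g"] by (simp add: field_simps power2_eq_square)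
  qed
  then have "sqrt ((ip M f g)\<^sup>2) \<le> sqrt (ip M f f * ip M g g)"
    by (rule real_sqrt_le_mono)
  then show ?thesis
    by (simp add: L2_seminorm_eq_ip real_sqrt_mult)
qed

lemma L2_seminorm_triangle:
  assumes f: "f \<in> L2_fun M" and g: "g \<in> L2_fun M"
  shows "L2_seminorm M (\<lambda>x. f x + g x) \<le> L2_seminorm M f + L2_seminorm M g"
proof (rule power2_le_imp_le)
  show "(L2_seminorm M (\<lambda>x. f x + g x))\<^sup>2 \<le> (L2_seminorm M f + L2_seminorm M g)\<^sup>2"
    using ip_Cauchy_Schwarz[OF f g] by (simp add: L2_seminorm_sq ip_add_self[OF f g] power2_sum)
qed simp

lemma L2_seminorm_scale: "L2_seminorm M (\<lambda>x. c * f x) = \<bar>c\<bar> * L2_seminorm M f"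
  by (simp add: L2_seminorm_def power_mult_distrib real_sqrt_mult)

lemma L2_seminorm_zero [simp]: "L2_seminorm M (\<lambda>x. 0) = 0"
  by (simp add: L2_seminorm_def)

lemma L2_seminorm_sum:
  "(\<And>i. i \<in> I \<Longrightarrow> f i \<in> L2_fun M) \<Longrightarrow>
   L2_seminorm M (\<lambda>x. \<Sum>i\<in>I. c i * f i x) \<le> (\<Sum>i\<in>I. \<bar>c i\<bar> * L2_seminorm M (f i))"
proof (induction I rule: infinite_finite_induct)
  case (insert i I)
  have "L2_seminorm M (\<lambda>x. c i * f i x + (\<Sum>i\<in>I. c i * f i x))
      \<le> L2_seminorm M (\<lambda>x. c i * f i x) + L2_seminorm M (\<lambda>x. \<Sum>i\<in>I. c i * f i x)"
    using insert.prems by (intro L2_seminorm_triangle L2_fun_scale L2_fun_sum) auto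
  also have "\<dots> \<le> \<bar>c i\<bar> * L2_seminorm M (f i) + (\<Sum>i\<in>I. \<bar>c i\<bar> * L2_seminorm M (f i))"
    using insert by (simp add: L2_seminorm_scale)
  finally show ?case using insert by simp
qed auto

lemma L2_seminorm_uminus: "L2_seminorm M (\<lambda>x. - f x) = L2_seminorm M f"
  by (simp add: L2_seminorm_def)

lemma L2_fun_uminus: "f \<in> L2_fun M \<Longrightarrow> (\<lambda>x. - f x) \<in> L2_fun M"
  using L2_fun_scale[of f M "- 1"] by simp

lemma L2_dist_commute: "L2_dist M f g = L2_dist M g f"
  by (simp add: L2_dist_def L2_seminorm_def power2_commute)

lemma L2_dist_triangle:
  assumes "f \<in> L2_fun M" "g \<in> L2_fun M" "h \<in> L2_fun M"
  shows "L2_dist M f h \<le> L2_dist M f g + L2_dist M g h"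
  using L2_seminorm_triangle[OF L2_fun_diff[OF assms(1,2)] L2_fun_diff[OF assms(2,3)]]
  by (simp add: L2_dist_def)

section \<open>Projections and Gram-Schmidt orthogonalisation\<close>

text \<open>
  Members of norm zero are admitted. Gram-Schmidt can then be run on a sequence with linear
  dependences without dropping terms, and a member of norm zero does not affect any projection,
  since its coefficients vanish by Cauchy-Schwarz.
\<close>

definition orthosys :: "'a measure \<Rightarrow> 'i set \<Rightarrow> ('i \<Rightarrow> 'a \<Rightarrow> real) \<Rightarrow> bool" where
  "orthosys M I e \<longleftrightarrow> (\<forall>i\<in>I. e i \<in> L2_fun M) \<and>
     (\<forall>i\<in>I. \<forall>j\<in>I. i \<noteq> j \<longrightarrow> ip M (e i) (e j) = 0) \<and>
     (\<forall>i\<in>I. ip M (e i) (e i) \<in> {0, 1})"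

text \<open>
  For an \<open>orthosys\<close> this is \<open>f\<close> minus its orthogonal projection onto the span.
\<close>

definition residual :: "'a measure \<Rightarrow> 'i set \<Rightarrow> ('i \<Rightarrow> 'a \<Rightarrow> real) \<Rightarrow> ('a \<Rightarrow> real) \<Rightarrow> 'a \<Rightarrow> real" where
  "residual M I e f = (\<lambda>x. f x - (\<Sum>i\<in>I. ip M f (e i) * e i x))"

lemma orthosys_subset: "orthosys M I e \<Longrightarrow> J \<subseteq> I \<Longrightarrow> orthosys M J e"
  by (auto simp: orthosys_def subset_iff)

lemma residual_L2: "orthosys M I e \<Longrightarrow> f \<in> L2_fun M \<Longrightarrow> residual M I e f \<in> L2_fun M"
  unfolding residual_def by (intro L2_fun_diff L2_fun_sum) (auto simp: orthosys_def)

lemma orthosys_ip_sum: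
  assumes "orthosys M I e" "finite I" "j \<in> I"
  shows "ip M (\<lambda>x. \<Sum>i\<in>I. c i * e i x) (e j) = c j * ip M (e j) (e j)"
proof -
  have "ip M (\<lambda>x. \<Sum>i\<in>I. c i * e i x) (e j) = (\<Sum>i\<in>I. c i * ip M (e i) (e j))"
    using assms by (intro ip_sum) (auto simp: orthosys_def)
  also have "\<dots> = (\<Sum>i\<in>I. if i = j then c j * ip M (e j) (e j) else 0)"
    using assms by (intro sum.cong) (auto simp: orthosys_def)
  finally show ?thesis using assms by simp
qed

lemma orthosys_sum_self:
  assumes "orthosys M I e" "finite I"
  shows "ip M (\<lambda>x. \<Sum>i\<in>I. c i * e i x) (\<lambda>x. \<Sum>i\<in>I. c i * e i x)
       = (\<Sum>i\<in>I. (c i)\<^sup>2 * ip M (e i) (e i))"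
proof -
  let ?s = "\<lambda>x. \<Sum>i\<in>I. c i * e i x"
  have "?s \<in> L2_fun M" using assms by (intro L2_fun_sum) (auto simp: orthosys_def)
  then have "ip M ?s ?s = (\<Sum>i\<in>I. c i * ip M ?s (e i))"
    using assms by (intro ip_sum_right) (auto simp: orthosys_def)
  also have "\<dots> = (\<Sum>i\<in>I. (c i)\<^sup>2 * ip M (e i) (e i))"
    using orthosys_ip_sum[OF assms] by (intro sum.cong) (auto simp: power2_eq_square)
  finally show ?thesis .
qed

lemma orthosys_sum_seminorm:
  assumes "orthosys M I e" "finite I"
  shows "(L2_seminorm M (\<lambda>x. \<Sum>i\<in>I. c i * e i x))\<^sup>2 \<le> (\<Sum>i\<in>I. (c i)\<^sup>2)"
  unfolding L2_seminorm_sq orthosys_sum_self[OF assms]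
  using assms(1) by (intro sum_mono) (auto simp: orthosys_def)

lemma orthosys_coeff:
  assumes "orthosys M I e" "i \<in> I" "f \<in> L2_fun M"
  shows "ip M f (e i) * ip M (e i) (e i) = ip M f (e i)"
proof (cases "ip M (e i) (e i) = 0")
  case True
  then show ?thesis
    using ip_Cauchy_Schwarz[of f M "e i"] assms by (auto simp: orthosys_def L2_seminorm_eq_ip)
next
  case False
  then show ?thesis using assms by (auto simp: orthosys_def)
qed

lemma residual_seminorm:
  assumes "orthosys M I e" "finite I" "f \<in> L2_fun M"
  shows "(L2_seminorm M (residual M I e f))\<^sup>2 = (L2_seminorm M f)\<^sup>2 - (\<Sum>i\<in>I. (ip M f (e i))\<^sup>2)"
proof -
  let ?s = "\<lambda>x. \<Sum>i\<in>I. ip M f (e i) * e i x"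
  have s: "?s \<in> L2_fun M" using assms by (intro L2_fun_sum) (auto simp: orthosys_def)
  have 1: "ip M f ?s = (\<Sum>i\<in>I. (ip M f (e i))\<^sup>2)"
    unfolding power2_eq_square using assms by (intro ip_sum_right) (auto simp: orthosys_def)
  have 2: "ip M ?s ?s = (\<Sum>i\<in>I. (ip M f (e i))\<^sup>2)"
    unfolding orthosys_sum_self[OF assms(1,2)]
    using orthosys_coeff[OF assms(1) _ assms(3)]
    by (intro sum.cong) (auto simp: power2_eq_square mult.assoc)
  show ?thesis
    unfolding residual_def L2_seminorm_sq ip_diff_self[OF assms(3) s] 1 2 by simp
qed

lemma residual_contraction:
  assumes "orthosys M I e" "finite I" "f \<in> L2_fun M"
  shows "L2_seminorm M (residual M I e f) \<le> L2_seminorm M f"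
    and "(\<Sum>i\<in>I. (ip M f (e i))\<^sup>2) \<le> (L2_seminorm M f)\<^sup>2"
proof -
  show "L2_seminorm M (residual M I e f) \<le> L2_seminorm M f"
    by (rule power2_le_imp_le) (simp_all add: residual_seminorm[OF assms] sum_nonneg)
  show "(\<Sum>i\<in>I. (ip M f (e i))\<^sup>2) \<le> (L2_seminorm M f)\<^sup>2"
    using residual_seminorm[OF assms] zero_le_power2[of "L2_seminorm M (residual M I e f)"] by linarith
qed

lemma residual_sum:
  assumes "orthosys M I e" "\<And>a. a \<in> A \<Longrightarrow> g a \<in> L2_fun M"
  shows "residual M I e (\<lambda>x. \<Sum>a\<in>A. c a * g a x) = (\<lambda>x. \<Sum>a\<in>A. c a * residual M I e (g a) x)"
proof
  fix x
  have "(\<Sum>i\<in>I. ip M (\<lambda>x. \<Sum>a\<in>A. c a * g a x) (e i) * e i x)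
      = (\<Sum>i\<in>I. (\<Sum>a\<in>A. c a * ip M (g a) (e i)) * e i x)"
    using assms by (intro sum.cong refl) (subst ip_sum, auto simp: orthosys_def)
  also have "\<dots> = (\<Sum>a\<in>A. c a * (\<Sum>i\<in>I. ip M (g a) (e i) * e i x))"
    unfolding sum_distrib_left sum_distrib_right
    by (subst sum.swap) (simp add: mult_ac)
  finally show "residual M I e (\<lambda>x. \<Sum>a\<in>A. c a * g a x) x = (\<Sum>a\<in>A. c a * residual M I e (g a) x)"
    by (simp add: residual_def right_diff_distrib sum_subtractf)
qed

lemma residual_diff:
  assumes "orthosys M I e" "f \<in> L2_fun M" "g \<in> L2_fun M"
  shows "residual M I e (\<lambda>x. f x - g x) = (\<lambda>x. residual M I e f x - residual M I e g x)"
proof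
  fix x
  have "(\<Sum>i\<in>I. ip M (\<lambda>x. f x - g x) (e i) * e i x)
      = (\<Sum>i\<in>I. (ip M f (e i) - ip M g (e i)) * e i x)"
    using assms by (intro sum.cong refl) (subst ip_diff, auto simp: orthosys_def)
  then show "residual M I e (\<lambda>x. f x - g x) x = residual M I e f x - residual M I e g x"
    by (simp add: residual_def left_diff_distrib sum_subtractf)
qed

text \<open>
  If the residual has norm zero, the division by zero makes the new member the zero function.
\<close>

fun gram_schmidt :: "'a measure \<Rightarrow> (nat \<Rightarrow> 'a \<Rightarrow> real) \<Rightarrow> nat \<Rightarrow> 'a \<Rightarrow> real" where
  "gram_schmidt M F n =
     (let r = (\<lambda>x. F n x - (\<Sum>i\<in>{..<n}. ip M (F n) (gram_schmidt M F i) * gram_schmidt M F i x))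
      in (\<lambda>x. r x / L2_seminorm M r))"

declare gram_schmidt.simps [simp del]

lemma gram_schmidt_residual:
  "gram_schmidt M F n =
     (\<lambda>x. residual M {..<n} (gram_schmidt M F) (F n) x /
          L2_seminorm M (residual M {..<n} (gram_schmidt M F) (F n)))"
  by (subst gram_schmidt.simps) (simp add: residual_def Let_def)

lemma ip_residual_sys:
  assumes "orthosys M I e" "finite I" "f \<in> L2_fun M" "j \<in> I"
  shows "ip M (residual M I e f) (e j) = 0"
proof -
  have "ip M (residual M I e f) (e j) = ip M f (e j) - ip M (\<lambda>x. \<Sum>i\<in>I. ip M f (e i) * e i x) (e j)"
    unfolding residual_def using assms by (intro ip_diff L2_fun_sum) (auto simp: orthosys_def)
  then show ?thesis
    using orthosys_ip_sum[OF assms(1,2,4)] orthosys_coeff[OF assms(1,4,3)] by simp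
qed

lemma gram_schmidt_orthosys_lessThan:
  assumes F: "\<And>n. F n \<in> L2_fun M"
  shows "orthosys M {..<n} (gram_schmidt M F)"
proof (induction n)
  case 0
  then show ?case by (simp add: orthosys_def)
next
  case (Suc n)
  let ?e = "gram_schmidt M F" and ?r = "residual M {..<n} (gram_schmidt M F) (F n)"
  have r: "?r \<in> L2_fun M" by (rule residual_L2[OF Suc F])
  have e: "?e n = (\<lambda>x. ?r x / L2_seminorm M ?r)" by (rule gram_schmidt_residual)
  have 1: "?e n \<in> L2_fun M" unfolding e by (rule L2_fun_divide[OF r])
  have 2: "ip M (?e n) (?e i) = 0" if "i < n" for i
    using ip_residual_sys[OF Suc _ F, of i n] that e by (simp add: ip_divide)
  then have h2: "ip M (?e i) (?e n) = 0" if "i < n" for i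
    using that by (simp add: ip_commute[of M "?e i"])
  have "ip M (?e n) (?e n) = ip M ?r ?r / (L2_seminorm M ?r)\<^sup>2"
    unfolding e by (simp add: ip_divide ip_divide_right power2_eq_square)
  then have 3: "ip M (?e n) (?e n) \<in> {0, 1}"
    by (simp add: L2_seminorm_sq)
  show ?case
    using Suc 1 2 h2 3 by (auto simp: orthosys_def less_Suc_eq)
qed

lemma gram_schmidt_orthosys:
  assumes "\<And>n. F n \<in> L2_fun M"
  shows "orthosys M UNIV (gram_schmidt M F)"
proof -
  have *: "orthosys M {..<n} (gram_schmidt M F)" for n
    by (rule gram_schmidt_orthosys_lessThan[OF assms])
  have 1: "gram_schmidt M F i \<in> L2_fun M"
    and 2: "ip M (gram_schmidt M F i) (gram_schmidt M F i) \<in> {0, 1}"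
    and 3: "i \<noteq> j \<Longrightarrow> ip M (gram_schmidt M F i) (gram_schmidt M F j) = 0" for i j
  proof -
    have i: "i \<in> {..<Suc (max i j)}" and j: "j \<in> {..<Suc (max i j)}" by auto
    show "gram_schmidt M F i \<in> L2_fun M" "ip M (gram_schmidt M F i) (gram_schmidt M F i) \<in> {0, 1}"
      "i \<noteq> j \<Longrightarrow> ip M (gram_schmidt M F i) (gram_schmidt M F j) = 0"
      using *[of "Suc (max i j)"] i j unfolding orthosys_def by simp_all
  qed
  show ?thesis unfolding orthosys_def using 1 2 3 by simp
qed

text \<open>
  At step \<open>n\<close> the new member points in the direction of what was missing from \<open>F n\<close>, so its
  coefficient carries the whole remaining squared norm.
\<close>

lemma gram_schmidt_residual_null:
  assumes F: "\<And>n. F n \<in> L2_fun M" and "n < N"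
  shows "L2_seminorm M (residual M {..<N} (gram_schmidt M F) (F n)) = 0"
proof -
  let ?e = "gram_schmidt M F" and ?r = "residual M {..<n} (gram_schmidt M F) (F n)"
  have os: "orthosys M {..<k} ?e" for k by (rule gram_schmidt_orthosys_lessThan[OF F])
  have r: "?r \<in> L2_fun M" by (rule residual_L2[OF os F])
  have e: "?e n = (\<lambda>x. ?r x / L2_seminorm M ?r)" by (rule gram_schmidt_residual)
  let ?s = "\<lambda>x. \<Sum>i\<in>{..<n}. ip M (F n) (?e i) * ?e i x"
  have eL: "?e k \<in> L2_fun M" for k
    using os[of "Suc k"] by (simp add: orthosys_def)
  have s: "?s \<in> L2_fun M" using eL by (intro L2_fun_sum) auto
  \<comment> \<open>The part of \<open>F n\<close> already spanned is orthogonal to the new member, so the coefficient is the norm of the residual.\<close>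
  have "ip M ?s (?e n) = (\<Sum>i\<in>{..<n}. ip M (F n) (?e i) * ip M (?e i) (?e n))"
    using eL by (intro ip_sum) auto
  also have "\<dots> = 0"
    using os[of "Suc n"] by (intro sum.neutral) (auto simp: orthosys_def)
  finally have "ip M (F n) (?e n) = ip M ?r (?e n)"
    unfolding residual_def using ip_diff[OF F s eL, of n n] by simp
  also have "\<dots> = L2_seminorm M ?r"
    unfolding e by (simp add: ip_divide_right power2_eq_square flip: L2_seminorm_sq)
  finally have c: "(ip M (F n) (?e n))\<^sup>2 = (L2_seminorm M ?r)\<^sup>2" by simp
  have "(\<Sum>i<n. (ip M (F n) (?e i))\<^sup>2) + (ip M (F n) (?e n))\<^sup>2 = (\<Sum>i<Suc n. (ip M (F n) (?e i))\<^sup>2)"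
    by simp
  also have "\<dots> \<le> (\<Sum>i<N. (ip M (F n) (?e i))\<^sup>2)"
    using \<open>n < N\<close> by (intro sum_mono2) auto
  finally have "(L2_seminorm M (residual M {..<N} ?e (F n)))\<^sup>2 \<le> 0"
    using c residual_seminorm[OF os _ F, of n n] residual_seminorm[OF os _ F, of N n] by simp
  then show ?thesis by simp
qed

text \<open>
  The residual map is linear, contracts norms and kills the span of the \<open>F n\<close>, so \<open>\<psi>\<close> may be
  replaced by \<open>\<psi> - f\<close>.
\<close>

lemma gram_schmidt_best_approximation:
  assumes F: "\<And>n. F n \<in> L2_fun M" and \<psi>: "\<psi> \<in> L2_fun M" and B: "B \<subseteq> {..<N}"
    and f: "AE x in M. f x = (\<Sum>n\<in>B. c n * F n x)" "f \<in> L2_fun M"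
  shows "L2_seminorm M (residual M {..<N} (gram_schmidt M F) \<psi>) \<le> L2_dist M \<psi> f"
proof -
  let ?e = "gram_schmidt M F" and ?f = "\<lambda>x. \<Sum>n\<in>B. c n * F n x"
  have os: "orthosys M {..<k} ?e" for k by (rule gram_schmidt_orthosys_lessThan[OF F])
  have fL: "?f \<in> L2_fun M" using F by (intro L2_fun_sum) auto
  let ?R = "residual M {..<N} ?e"
  have "L2_seminorm M (?R ?f) = L2_seminorm M (\<lambda>x. \<Sum>n\<in>B. c n * ?R (F n) x)"
    by (simp add: residual_sum[OF os F])
  also have "\<dots> \<le> (\<Sum>n\<in>B. \<bar>c n\<bar> * L2_seminorm M (?R (F n)))"
    by (intro L2_seminorm_sum residual_L2 os F)
  also have "\<dots> = 0"
    using gram_schmidt_residual_null[of F M _ N, OF F] B by (intro sum.neutral) (auto simp: subset_iff)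
  finally have 0: "L2_seminorm M (?R ?f) = 0" by (simp add: order_antisym)
  have "?R \<psi> = (\<lambda>x. ?R (\<lambda>x. \<psi> x - ?f x) x + ?R ?f x)"
    by (simp add: residual_diff[OF os \<psi> fL])
  then have "L2_seminorm M (?R \<psi>) \<le> L2_seminorm M (?R (\<lambda>x. \<psi> x - ?f x)) + L2_seminorm M (?R ?f)"
    using L2_seminorm_triangle[OF residual_L2[OF os L2_fun_diff[OF \<psi> fL]] residual_L2[OF os fL], of N N]
    by simp
  also have "\<dots> \<le> L2_seminorm M (\<lambda>x. \<psi> x - ?f x)"
    using 0 residual_contraction(1)[OF os _ L2_fun_diff[OF \<psi> fL], of N] by simp
  also have "\<dots> = L2_dist M \<psi> f"
    unfolding L2_dist_def L2_seminorm_def using f \<psi> fL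
    by (intro arg_cong[where f=sqrt] integral_cong_AE) (auto simp: L2_fun_def)
  finally show ?thesis .
qed

section \<open>Sparse index sets\<close>

text \<open>
  The index set of a sparse grid (hyperbolic cross): \<open>lev n\<close> is the level of the basis element
  \<open>n\<close>, and the levels along the \<open>d\<close> axes may add up to at most \<open>k\<close>.
\<close>

definition sparse :: "(nat \<Rightarrow> nat) \<Rightarrow> nat \<Rightarrow> nat \<Rightarrow> (nat \<Rightarrow> nat) set" where
  "sparse lev d k = {i \<in> extensional {..<d}. (\<Sum>l<d. lev (i l)) \<le> k}"

lemma sparse_0: "sparse lev 0 k = {\<lambda>_. undefined}"
  by (auto simp: sparse_def)

lemma sparse_Suc:
  "sparse lev (Suc d) k =
     (\<lambda>(n, i). i(d := n)) ` (SIGMA n:{n. lev n \<le> k}. sparse lev d (k - lev n))"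
proof (intro equalityI subsetI)
  fix i assume i: "i \<in> sparse lev (Suc d) k"
  let ?j = "restrict i {..<d}"
  have "(\<Sum>l<d. lev (?j l)) = (\<Sum>l<d. lev (i l))"
    by (intro sum.cong) auto
  moreover have "(\<Sum>l<d. lev (i l)) + lev (i d) \<le> k"
    using i by (simp add: sparse_def)
  ultimately have sum: "(\<Sum>l<d. lev (?j l)) \<le> k - lev (i d)" and "lev (i d) \<le> k"
    by linarith+
  moreover have ext: "?j \<in> extensional {..<d}"
    by (rule restrict_extensional)
  have "?j \<in> sparse lev d (k - lev (i d))" 
    unfolding sparse_def by (intro CollectI conjI ext sum)
  moreover have "i = ?j(d := i d)"
  proof
    fix l
    have "i \<in> extensional {..<Suc d}" using i unfolding sparse_def by blast
    then have "i l = undefined" if "\<not> l < Suc d"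
      using that by (simp add: extensional_def)
    then show "i l = (?j(d := i d)) l"
      by (cases "l < d"; cases "l = d") (simp_all add: less_Suc_eq)
  qed
  ultimately show "i \<in> (\<lambda>(n, i). i(d := n)) ` (SIGMA n:{n. lev n \<le> k}. sparse lev d (k - lev n))"
    by (intro image_eqI[of _ _ "(i d, ?j)"]) auto
next
  fix i assume "i \<in> (\<lambda>(n, i). i(d := n)) ` (SIGMA n:{n. lev n \<le> k}. sparse lev d (k - lev n))"
  then obtain n j where *: "i = j(d := n)" "lev n \<le> k" "j \<in> sparse lev d (k - lev n)"
    by auto
  have "(\<Sum>l<d. lev (i l)) = (\<Sum>l<d. lev (j l))"
    unfolding *(1) by (intro sum.cong) auto
  moreover have "i \<in> extensional {..<Suc d}"
    unfolding extensional_def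
  proof (intro CollectI allI impI)
    fix l assume "l \<notin> {..<Suc d}"
    moreover have "j \<in> extensional {..<d}" using *(3) unfolding sparse_def by blast
    ultimately show "i l = undefined"
      unfolding *(1) using extensional_arb[of j "{..<d}" l] by simp
  qed
  moreover have "(\<Sum>l<d. lev (j l)) \<le> k - lev n" "i d = n"
    using * by (simp_all add: sparse_def)
  ultimately show "i \<in> sparse lev (Suc d) k"
    unfolding sparse_def using *(2) by (intro CollectI conjI) simp_all
qed

lemma sparse_Suc_inj:
  "inj_on (\<lambda>(n, i). i(d := n)) (SIGMA n:{n. lev n \<le> k}. sparse lev d (k - lev n))"
proof (rule inj_onI)
  fix p q
  assume p: "p \<in> (SIGMA n:{n. lev n \<le> k}. sparse lev d (k - lev n))"
    and q: "q \<in> (SIGMA n:{n. lev n \<le> k}. sparse lev d (k - lev n))"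
    and "(case p of (n, i) \<Rightarrow> i(d := n)) = (case q of (n, i) \<Rightarrow> i(d := n))"
  then have eq: "(snd p)(d := fst p) = (snd q)(d := fst q)"
    by (simp add: case_prod_unfold)
  have ext: "snd p \<in> extensional {..<d}" "snd q \<in> extensional {..<d}"
    using p q by (auto simp: sparse_def)
  have "snd p l = snd q l" for l
    using extensional_arb[OF ext(1), of l] extensional_arb[OF ext(2), of l] fun_cong[OF eq, of l] by (cases "l = d") auto
  moreover have "fst p = fst q"
    using fun_cong[OF eq, of d] by simp
  ultimately show "p = q" by (simp add: prod_eq_iff fun_eq_iff)
qed

lemma finite_sparse:
  assumes "\<And>k. finite {n. lev n \<le> k}"
  shows "finite (sparse lev d k)"
proof (rule finite_subset)
  show "sparse lev d k \<subseteq> PiE {..<d} (\<lambda>_. {n. lev n \<le> k})"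
  proof
    fix i assume i: "i \<in> sparse lev d k"
    have "lev (i l) \<le> k" if "l < d" for l
      using i member_le_sum[of l "{..<d}" "\<lambda>l. lev (i l)"] that by (auto simp: sparse_def)
    then show "i \<in> PiE {..<d} (\<lambda>_. {n. lev n \<le> k})"
      using i by (simp add: sparse_def PiE_def Pi_def)
  qed
qed (auto intro!: finite_PiE assms)

text \<open>
  Splitting off the last coordinate leaves the level budget \<open>k - lev n\<close> for the others. Both
  the cardinality and the error of the sparse grid are controlled by induction through this
  identity.
\<close>

lemma sum_sparse_Suc:
  fixes w :: "nat \<Rightarrow> nat \<Rightarrow> real"
  assumes "\<And>k. finite {n. lev n \<le> k}"
  shows "(\<Sum>i\<in>sparse lev (Suc d) k. \<Prod>l<Suc d. w l (i l))
       = (\<Sum>n | lev n \<le> k. w d n * (\<Sum>i\<in>sparse lev d (k - lev n). \<Prod>l<d. w l (i l)))"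
proof -
  have *: "(\<Prod>l<d. w l ((i(d := n)) l)) = (\<Prod>l<d. w l (i l))" for i n
    by (intro prod.cong) auto
  have "(\<Sum>i\<in>sparse lev (Suc d) k. \<Prod>l<Suc d. w l (i l))
      = (\<Sum>(n, i)\<in>(SIGMA n:{n. lev n \<le> k}. sparse lev d (k - lev n)). w d n * (\<Prod>l<d. w l (i l)))"
    unfolding sparse_Suc by (subst sum.reindex[OF sparse_Suc_inj]) (auto simp: * case_prod_unfold mult.commute intro!: sum.cong)
  also have "\<dots> = (\<Sum>n | lev n \<le> k. \<Sum>i\<in>sparse lev d (k - lev n). w d n * (\<Prod>l<d. w l (i l)))"
    using assms finite_sparse[OF assms] by (subst sum.Sigma) auto
  finally show ?thesis by (simp add: sum_distrib_left)
qed

text \<open>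
  Each of the \<open>k + 1\<close> levels contributes at most \<open>A r^k\<close>. This is where one factor
  \<open>k + 1\<close> per additional dimension comes from.
\<close>

lemma sum_weighted_levels:
  fixes w :: "nat \<Rightarrow> real"
  assumes fin: "\<And>k. finite {n. lev n \<le> k}" and r: "0 < r"
    and w: "\<And>j. (\<Sum>n | lev n = j. w n) \<le> A * r ^ j"
  shows "(\<Sum>n | lev n \<le> k. w n * r ^ (k - lev n)) \<le> A * (real k + 1) * r ^ k"
proof -
  have fin': "finite {n. lev n = j}" for j
    by (rule finite_subset[OF _ fin[of j]]) auto
  have "(\<Sum>n | lev n \<le> k. w n * r ^ (k - lev n))
      = (\<Sum>j\<le>k. \<Sum>n | n \<in> {n. lev n \<le> k} \<and> lev n = j. w n * r ^ (k - lev n))"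
    by (subst sum.group[OF fin]) auto
  also have "\<dots> = (\<Sum>j\<le>k. r ^ (k - j) * (\<Sum>n | lev n = j. w n))"
    unfolding sum_distrib_left by (intro sum.cong refl) (auto simp: mult.commute)
  also have "\<dots> \<le> (\<Sum>j\<le>k. r ^ (k - j) * (A * r ^ j))"
    using r w by (intro sum_mono mult_left_mono) auto
  also have "\<dots> = (\<Sum>j\<le>k. A * r ^ k)"
    by (intro sum.cong refl) (simp add: power_add[symmetric])
  finally show ?thesis by (simp add: algebra_simps)
qed

lemma card_sparse_le:
  assumes fin: "\<And>k. finite {n. lev n \<le> k}" and A: "A \<ge> 1"
    and card: "\<And>k. real (card {n. lev n \<le> k}) \<le> A * 2 ^ k"
  shows "real (card (sparse lev (Suc d) k)) \<le> A ^ Suc d * (real k + 1) ^ d * 2 ^ k"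
proof (induction d arbitrary: k)
  case 0
  then show ?case
    using sum_sparse_Suc[where lev=lev and d=0 and k=k and w="\<lambda>_ _. 1", OF fin] card by (simp add: sparse_0)
next
  case (Suc d)
  have lev_eq: "(\<Sum>n | lev n = j. 1) \<le> A * (2 :: real) ^ j" for j
  proof -
    have "card {n. lev n = j} \<le> card {n. lev n \<le> j}"
      by (rule card_mono[OF fin]) auto
    then show ?thesis using card[of j] by simp
  qed
  have "real (card (sparse lev (Suc (Suc d)) k))
      = (\<Sum>n | lev n \<le> k. real (card (sparse lev (Suc d) (k - lev n))))"
    using sum_sparse_Suc[where lev=lev and d="Suc d" and k=k and w="\<lambda>_ _. 1", OF fin] by simp
  also have "\<dots> \<le> (\<Sum>n | lev n \<le> k. A ^ Suc d * (real (k - lev n) + 1) ^ d * 2 ^ (k - lev n))"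
    by (intro sum_mono Suc.IH)
  also have "\<dots> \<le> (\<Sum>n | lev n \<le> k. A ^ Suc d * (real k + 1) ^ d * 2 ^ (k - lev n))"
    using A by (intro sum_mono mult_right_mono mult_left_mono power_mono) auto
  also have "\<dots> = A ^ Suc d * (real k + 1) ^ d * (\<Sum>n | lev n \<le> k. 1 * 2 ^ (k - lev n))"
    by (simp add: sum_distrib_left)
  also have "\<dots> \<le> A ^ Suc d * (real k + 1) ^ d * (A * (real k + 1) * 2 ^ k)"
    using A by (intro mult_left_mono sum_weighted_levels[where lev=lev, OF fin] lev_eq) auto
  finally show ?case by (simp add: mult_ac)
qed

text \<open>
  Here \<open>x l\<close> plays the role of a squared norm, \<open>w l n\<close> that of a squared coefficient, and the
  left-hand side is the squared norm of what a product loses when it is projected onto the sparse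
  grid. In the induction, the loss consists of the tail in the last coordinate alone, and, for every
  retained index \<open>n\<close> in that coordinate, of the loss in the other coordinates with the budget
  \<open>k - lev n\<close>. The weight of level \<open>j\<close> is bounded by the tail beyond level \<open>j - 1\<close>, which
  accounts for the division by \<open>\<rho>\<close>.
\<close>

lemma sparse_tail_le:
  fixes w :: "nat \<Rightarrow> nat \<Rightarrow> real" and x :: "nat \<Rightarrow> real"
  assumes fin: "\<And>k. finite {n. lev n \<le> k}" and G: "G \<ge> 1" and \<rho>: "0 < \<rho>" "\<rho> \<le> 1"
    and w: "\<And>l n. 0 \<le> w l n" and x: "\<And>l. 0 \<le> x l" "\<And>l. x l \<le> 1"
    and le: "\<And>l k. (\<Sum>n | lev n \<le> k. w l n) \<le> x l"
    and tail: "\<And>l k. x l - (\<Sum>n | lev n \<le> k. w l n) \<le> G * \<rho> ^ k"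
  shows "(\<Prod>l<Suc d. x l) - (\<Sum>i\<in>sparse lev (Suc d) k. \<Prod>l<Suc d. w l (i l))
       \<le> (2 * G / \<rho>) ^ Suc d * (real k + 1) ^ d * \<rho> ^ k"
proof (induction d arbitrary: k)
  case 0
  have "G * \<rho> ^ k \<le> 2 * G / \<rho> * \<rho> ^ k"
    using G \<rho> by (intro mult_right_mono) (auto simp: field_simps)
  then show ?case
    using sum_sparse_Suc[where lev=lev and d=0 and k=k and w=w, OF fin] tail[of 0 k] by (simp add: sparse_0)
next
  case (Suc d)
  define B where "B = G / \<rho>"
  define X where "X = (\<Prod>l<Suc d. x l)"
  define S where "S = (\<lambda>k. \<Sum>i\<in>sparse lev (Suc d) k. \<Prod>l<Suc d. w l (i l))"
  define C where "C = (2 * G / \<rho>) ^ Suc d"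
  have S_eq: "(\<Sum>i\<in>sparse lev (Suc d) j. \<Prod>l<Suc d. w l (i l)) = S j" for j
    by (simp add: S_def)
  have X: "0 \<le> X" "X \<le> 1"
    unfolding X_def by (rule prod_nonneg, simp add: x) (rule prod_le_1, simp add: x)
  have B: "G \<le> B" "1 \<le> B" using G \<rho> by (auto simp: B_def field_simps)
  have C: "1 \<le> C" unfolding C_def using B(2) by (intro one_le_power) (simp add: B_def)
  have lev_eq: "(\<Sum>n | lev n = j. w l n) \<le> B * \<rho> ^ j" for j l
  proof (cases j)
    case 0
    then show ?thesis using le[of l 0] x(2)[of l] B by simp
  next
    case (Suc i)
    have "{n. lev n \<le> j} = {n. lev n \<le> i} \<union> {n. lev n = j}"
      using Suc by auto
    moreover have "finite {n. lev n = j}"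
      by (rule finite_subset[OF _ fin[of j]]) auto
    ultimately have "(\<Sum>n | lev n \<le> j. w l n) = (\<Sum>n | lev n \<le> i. w l n) + (\<Sum>n | lev n = j. w l n)"
      using Suc fin by (subst sum.union_disjoint[symmetric]) auto
    then have "(\<Sum>n | lev n = j. w l n) \<le> G * \<rho> ^ i"
      using le[of l j] tail[of l i] by linarith
    then show ?thesis using Suc \<rho> by (simp add: B_def)
  qed
  \<comment> \<open>The loss beyond level \<open>k\<close> in the last coordinate, and the losses in the other coordinates.\<close>
  have "X * x (Suc d) - (\<Sum>i\<in>sparse lev (Suc (Suc d)) k. \<Prod>l<Suc (Suc d). w l (i l))
      = X * (x (Suc d) - (\<Sum>n | lev n \<le> k. w (Suc d) n))
        + (\<Sum>n | lev n \<le> k. w (Suc d) n * (X - S (k - lev n)))"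
    unfolding sum_sparse_Suc[where lev=lev and d="Suc d" and k=k and w=w, OF fin] S_eq
    by (simp add: right_diff_distrib sum_subtractf sum_distrib_left mult.commute)
  also have "\<dots> \<le> 1 * (G * \<rho> ^ k)
        + (\<Sum>n | lev n \<le> k. w (Suc d) n * (C * (real k + 1) ^ d * \<rho> ^ (k - lev n)))"
  proof (rule add_mono)
    show "X * (x (Suc d) - (\<Sum>n | lev n \<le> k. w (Suc d) n)) \<le> 1 * (G * \<rho> ^ k)"
      using X le[of "Suc d" k] tail[of "Suc d" k] by (intro mult_mono) auto
  next
    show "(\<Sum>n | lev n \<le> k. w (Suc d) n * (X - S (k - lev n)))
       \<le> (\<Sum>n | lev n \<le> k. w (Suc d) n * (C * (real k + 1) ^ d * \<rho> ^ (k - lev n)))"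
  proof (intro sum_mono mult_left_mono w)
    fix n
    have "X - S (k - lev n) \<le> C * (real (k - lev n) + 1) ^ d * \<rho> ^ (k - lev n)"
      unfolding X_def S_def C_def by (rule Suc.IH)
    also have "\<dots> \<le> C * (real k + 1) ^ d * \<rho> ^ (k - lev n)"
      using \<rho> C by (intro mult_right_mono mult_left_mono power_mono) auto
    finally show "X - S (k - lev n) \<le> C * (real k + 1) ^ d * \<rho> ^ (k - lev n)" .
  qed
  qed
  also have "(\<Sum>n | lev n \<le> k. w (Suc d) n * (C * (real k + 1) ^ d * \<rho> ^ (k - lev n)))
      = C * (real k + 1) ^ d * (\<Sum>n | lev n \<le> k. w (Suc d) n * \<rho> ^ (k - lev n))"
    by (simp add: sum_distrib_left mult_ac)
  also have "\<dots> \<le> C * (real k + 1) ^ d * (B * (real k + 1) * \<rho> ^ k)"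
    using C by (intro mult_left_mono sum_weighted_levels[where lev=lev, OF fin \<rho>(1)] lev_eq) auto
  also have "1 * (G * \<rho> ^ k) \<le> C * (B * (real k + 1) ^ Suc d * \<rho> ^ k)"
  proof -
    have "1 * G \<le> C * (B * (real k + 1) ^ Suc d)"
    proof (rule mult_mono[OF C])
      have "B * 1 \<le> B * (real k + 1) ^ Suc d"
        using B by (intro mult_left_mono one_le_power) auto
      then show "G \<le> B * (real k + 1) ^ Suc d" using B by linarith
    qed (use C G in auto)
    then have "1 * G * \<rho> ^ k \<le> C * (B * (real k + 1) ^ Suc d) * \<rho> ^ k"
      using \<rho> by (intro mult_right_mono) auto
    then show ?thesis by (simp only: mult.assoc)
  qed
  finally have "X * x (Suc d) - (\<Sum>i\<in>sparse lev (Suc (Suc d)) k. \<Prod>l<Suc (Suc d). w l (i l))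
     \<le> C * (B * (real k + 1) ^ Suc d * \<rho> ^ k) + C * (real k + 1) ^ d * (B * (real k + 1) * \<rho> ^ k)"
    by simp
  also have "\<dots> = (2 * G / \<rho>) ^ Suc (Suc d) * (real k + 1) ^ Suc d * \<rho> ^ k"
  proof -
    have "(2 * G / \<rho>) ^ Suc (Suc d) = 2 * B * C"
      by (simp add: C_def B_def)
    then show ?thesis by (simp add: algebra_simps)
  qed
  finally show ?case by (simp add: X_def)
qed

section \<open>Sparse approximation of convex combinations\<close>

text \<open>
  Derandomised Maurey sampling. Choose \<open>h\<close> at random: the value \<open>g a\<close> with the sign of
  \<open>\<beta> a\<close> has probability \<open>\<bar>\<beta> a\<bar>\<close>, and \<open>0\<close> has the remaining probability. Then \<open>h\<close> has
  mean \<open>f\<close>, so the expected squared norm of \<open>S + (h - f)\<close> is the squared norm of \<open>S\<close> plus a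
  variance of at most \<open>\<sigma>\<^sup>2\<close>. Some outcome is no worse than this expectation; the proof takes the
  best element of \<open>G\<close> and bounds its value by the weighted mean.
\<close>

lemma maurey_step:
  assumes A: "finite A" and g: "\<And>a. a \<in> A \<Longrightarrow> g a \<in> L2_fun M"
    and \<sigma>: "\<And>a. a \<in> A \<Longrightarrow> L2_seminorm M (g a) \<le> \<sigma>"
    and \<beta>: "(\<Sum>a\<in>A. \<bar>\<beta> a\<bar>) \<le> 1"
    and G: "finite G" "(\<lambda>x. 0) \<in> G" "\<And>a. a \<in> A \<Longrightarrow> g a \<in> G" "\<And>a. a \<in> A \<Longrightarrow> (\<lambda>x. - g a x) \<in> G"
    and S: "S \<in> L2_fun M" and f: "f = (\<lambda>x. \<Sum>a\<in>A. \<beta> a * g a x)"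
  shows "\<exists>h\<in>G. (L2_seminorm M (\<lambda>x. (S x - f x) + h x))\<^sup>2 \<le> (L2_seminorm M S)\<^sup>2 + \<sigma>\<^sup>2"
proof -
  define u where "u = (\<lambda>x. S x - f x)"
  define val where "val = (\<lambda>h. (L2_seminorm M (\<lambda>x. u x + h x))\<^sup>2)"
  define m where "m = Min (val ` G)"
  have fL: "f \<in> L2_fun M" unfolding f by (intro L2_fun_sum g)
  have u: "u \<in> L2_fun M" unfolding u_def by (intro L2_fun_diff S fL)
  have "finite (val ` G)" "val ` G \<noteq> {}" using G by auto
  then have "m \<in> val ` G" and m_le: "\<And>h. h \<in> G \<Longrightarrow> m \<le> val h"
    unfolding m_def by (simp_all add: Min_in)
  then obtain h where h: "h \<in> G" "m = val h" by auto
  have val_0: "val (\<lambda>x. 0) = ip M u u"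
    by (simp add: val_def L2_seminorm_sq)
  have tm: "\<bar>\<beta> a\<bar> * m \<le> \<bar>\<beta> a\<bar> * (ip M u u + \<sigma>\<^sup>2) + 2 * (\<beta> a * ip M u (g a))" if a: "a \<in> A" for a
  proof -
    define s where "s = (if \<beta> a \<ge> 0 then 1 else - 1 :: real)"
    have "(\<lambda>x. s * g a x) \<in> G"
      using G(3,4)[OF a] by (simp add: s_def)
    then have "m \<le> val (\<lambda>x. s * g a x)" by (rule m_le)
    also have "\<dots> = ip M u u + 2 * (s * ip M u (g a)) + s * (s * ip M (g a) (g a))"
      unfolding val_def L2_seminorm_sq ip_add_self[OF u L2_fun_scale[OF g[OF a]]]
      by (simp add: ip_scale ip_scale_right)
    also have "s * (s * ip M (g a) (g a)) = (L2_seminorm M (g a))\<^sup>2"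
      by (simp add: s_def L2_seminorm_sq)
    also have "\<dots> \<le> \<sigma>\<^sup>2"
      using \<sigma>[OF a] by (intro power_mono) auto
    finally have "\<bar>\<beta> a\<bar> * m \<le> \<bar>\<beta> a\<bar> * (ip M u u + 2 * (s * ip M u (g a)) + \<sigma>\<^sup>2)"
      by (intro mult_left_mono) auto
    also have "\<dots> = \<bar>\<beta> a\<bar> * (ip M u u + \<sigma>\<^sup>2) + 2 * (\<bar>\<beta> a\<bar> * s * ip M u (g a))"
      by (simp add: algebra_simps)
    also have "\<bar>\<beta> a\<bar> * s = \<beta> a" by (simp add: s_def)
    finally show ?thesis .
  qed
  define b where "b = (\<Sum>a\<in>A. \<bar>\<beta> a\<bar>)"
  have b: "0 \<le> b" "b \<le> 1" using \<beta> by (auto simp: b_def sum_nonneg)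
  have ipf: "ip M u f = (\<Sum>a\<in>A. \<beta> a * ip M u (g a))"
    unfolding f by (intro ip_sum_right g u)
  \<comment> \<open>The minimum \<open>m\<close> is at most the mean of \<open>val\<close> with the weights \<open>\<bar>\<beta> a\<bar>\<close> and \<open>1 - b\<close>.\<close>
  have "b * m = (\<Sum>a\<in>A. \<bar>\<beta> a\<bar> * m)"
    by (simp add: b_def sum_distrib_right)
  also have "\<dots> \<le> (\<Sum>a\<in>A. \<bar>\<beta> a\<bar> * (ip M u u + \<sigma>\<^sup>2) + 2 * (\<beta> a * ip M u (g a)))"
    by (intro sum_mono tm)
  also have "\<dots> = b * (ip M u u + \<sigma>\<^sup>2) + 2 * ip M u f"
    unfolding ipf b_def by (simp add: sum.distrib sum_distrib_right sum_distrib_left)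
  finally have 1: "b * m \<le> b * (ip M u u + \<sigma>\<^sup>2) + 2 * ip M u f" .
  have "(1 - b) * m \<le> (1 - b) * ip M u u"
    using m_le[OF G(2)] b unfolding val_0 by (intro mult_left_mono) auto
  then have "m \<le> ip M u u + b * \<sigma>\<^sup>2 + 2 * ip M u f"
    using 1 by (simp add: algebra_simps)
  also have "b * \<sigma>\<^sup>2 \<le> 1 * \<sigma>\<^sup>2"
    using b by (intro mult_right_mono) auto
  finally have "m \<le> ip M u u + 2 * ip M u f + \<sigma>\<^sup>2" by simp
  also have "\<dots> \<le> (ip M u u + 2 * ip M u f + ip M f f) + \<sigma>\<^sup>2"
    using ip_self_nonneg[of M f] by simp
  also have "ip M u u + 2 * ip M u f + ip M f f = ip M S S"
    using ip_add_self[OF u fL] by (simp add: u_def)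
  finally have "val h \<le> (L2_seminorm M S)\<^sup>2 + \<sigma>\<^sup>2"
    using h by (simp add: L2_seminorm_sq)
  then show ?thesis using h(1) unfolding val_def u_def by blast
qed

text \<open>
  Every greedy step adds at most \<open>\<sigma>\<^sup>2\<close> to the squared distance between the sum of the chosen
  elements and the corresponding multiple of \<open>f\<close>.
\<close>

lemma maurey:
  assumes A: "finite A" and g: "\<And>a. a \<in> A \<Longrightarrow> g a \<in> L2_fun M"
    and \<sigma>: "\<And>a. a \<in> A \<Longrightarrow> L2_seminorm M (g a) \<le> \<sigma>"
    and \<beta>: "(\<Sum>a\<in>A. \<bar>\<beta> a\<bar>) \<le> 1"
    and G: "finite G" "(\<lambda>x. 0) \<in> G" "\<And>a. a \<in> A \<Longrightarrow> g a \<in> G" "\<And>a. a \<in> A \<Longrightarrow> (\<lambda>x. - g a x) \<in> G"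
    and GL: "G \<subseteq> L2_fun M"
    and f: "f = (\<lambda>x. \<Sum>a\<in>A. \<beta> a * g a x)"
  shows "\<exists>h. (\<forall>t<m. h t \<in> G) \<and>
           (L2_seminorm M (\<lambda>x. (\<Sum>t<m. h t x) - real m * f x))\<^sup>2 \<le> real m * \<sigma>\<^sup>2"
proof (induction m)
  case 0
  then show ?case by simp
next
  case (Suc m)
  then obtain h where h: "\<And>t. t < m \<Longrightarrow> h t \<in> G"
    and le: "(L2_seminorm M (\<lambda>x. (\<Sum>t<m. h t x) - real m * f x))\<^sup>2 \<le> real m * \<sigma>\<^sup>2"
    by auto
  let ?S = "\<lambda>x. (\<Sum>t<m. h t x) - real m * f x"
  have fL: "f \<in> L2_fun M" unfolding f by (intro L2_fun_sum g)
  have "(\<lambda>x. \<Sum>t<m. 1 * h t x) \<in> L2_fun M"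
    using h GL by (intro L2_fun_sum) auto
  then have "?S \<in> L2_fun M"
    by (intro L2_fun_diff L2_fun_scale fL) simp
  from maurey_step[OF A g \<sigma> \<beta> G this f] obtain k where k: "k \<in> G"
    "(L2_seminorm M (\<lambda>x. (?S x - f x) + k x))\<^sup>2 \<le> (L2_seminorm M ?S)\<^sup>2 + \<sigma>\<^sup>2"
    by auto
  define h' where "h' = h(m := k)"
  have "(\<Sum>t<m. h' t x) = (\<Sum>t<m. h t x)" for x
    unfolding h'_def by (intro sum.cong) auto
  then have "(\<lambda>x. (\<Sum>t<Suc m. h' t x) - real (Suc m) * f x) = (\<lambda>x. (?S x - f x) + k x)"
    by (intro ext) (simp add: h'_def algebra_simps)
  then have "(L2_seminorm M (\<lambda>x. (\<Sum>t<Suc m. h' t x) - real (Suc m) * f x))\<^sup>2 \<le> real (Suc m) * \<sigma>\<^sup>2"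
    using k(2) le by (simp add: algebra_simps)
  moreover have "\<forall>t<Suc m. h' t \<in> G"
    using h k(1) by (auto simp: h'_def less_Suc_eq)
  ultimately show ?case by blast
qed

text \<open>
  The approximating averages depend on the combination only through the choice of \<open>m\<close> elements
  of \<open>G\<close>, so a single finite set serves all combinations.
\<close>

lemma maurey_cover:
  assumes G: "finite G" "(\<lambda>x. 0) \<in> G" "\<And>h. h \<in> G \<Longrightarrow> (\<lambda>x. - h x) \<in> G"
    and GL: "G \<subseteq> L2_fun M" and m: "m \<ge> 1"
    and \<sigma>: "\<And>h. h \<in> G \<Longrightarrow> L2_seminorm M h \<le> \<sigma>" "0 \<le> \<sigma>"
  shows "\<exists>C. finite C \<and> C \<subseteq> L2_fun M \<and> card C \<le> card G ^ m \<and>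
    (\<forall>A \<beta> g. finite A \<longrightarrow> g ` A \<subseteq> G \<longrightarrow> (\<Sum>a\<in>A. \<bar>\<beta> a\<bar>) \<le> 1 \<longrightarrow>
       (\<exists>c\<in>C. L2_dist M c (\<lambda>x. \<Sum>a\<in>(A :: 'j set). \<beta> a * g a x) \<le> \<sigma> / sqrt (real m)))"
proof -
  define avg :: "(nat \<Rightarrow> 'a \<Rightarrow> real) \<Rightarrow> 'a \<Rightarrow> real" where
    "avg = (\<lambda>h x. \<Sum>t<m. (1 / real m) * h t x)"
  define H where "H = PiE {..<m} (\<lambda>_. G)"
  have fin: "finite H" unfolding H_def by (intro finite_PiE) (use G in auto)
  have card: "card H = card G ^ m" unfolding H_def by (subst card_PiE) auto
  have "finite (avg ` H)" using fin by simp
  moreover have "avg ` H \<subseteq> L2_fun M"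
  proof
    fix c assume "c \<in> avg ` H"
    then obtain h where h: "h \<in> H" "c = avg h" by auto
    have "h t \<in> L2_fun M" if "t < m" for t
      using h(1) that GL unfolding H_def by (auto dest!: PiE_mem)
    then show "c \<in> L2_fun M" unfolding h(2) avg_def by (intro L2_fun_sum) simp
  qed
  moreover have "card (avg ` H) \<le> card G ^ m"
    using card_image_le[OF fin, of avg] card by simp
  moreover have "\<exists>c\<in>avg ` H. L2_dist M c (\<lambda>x. \<Sum>a\<in>A. \<beta> a * g a x) \<le> \<sigma> / sqrt (real m)"
    if A: "finite A" "g ` A \<subseteq> G" "(\<Sum>a\<in>A. \<bar>\<beta> a\<bar>) \<le> 1" for A :: "'j set" and \<beta> g
  proof -
    define f where "f = (\<lambda>x. \<Sum>a\<in>A. \<beta> a * g a x)"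
    have gG: "g a \<in> G" if "a \<in> A" for a using A(2) that by auto
    have "g a \<in> L2_fun M" "L2_seminorm M (g a) \<le> \<sigma>" "(\<lambda>x. - g a x) \<in> G" if "a \<in> A" for a
      using gG[OF that] GL \<sigma> G(3) by auto
    from maurey[OF A(1) this(1) this(2) A(3) G(1,2) gG this(3) GL f_def, of m]
    obtain h where h: "\<forall>t<m. h t \<in> G"
      "(L2_seminorm M (\<lambda>x. (\<Sum>t<m. h t x) - real m * f x))\<^sup>2 \<le> real m * \<sigma>\<^sup>2"
      by auto
    define h' where "h' = restrict h {..<m}"
    have h': "h' \<in> H" unfolding H_def h'_def using h(1) by (intro restrict_PiE_iff[THEN iffD2]) auto
    have "avg h' = avg h" unfolding avg_def h'_def by (intro ext sum.cong) auto
    have "(\<lambda>x. avg h x - f x) = (\<lambda>x. (1 / real m) * ((\<Sum>t<m. h t x) - real m * f x))"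
      using m by (intro ext) (simp add: avg_def right_diff_distrib sum_divide_distrib)
    then have "L2_dist M (avg h) f = (1 / real m) * L2_seminorm M (\<lambda>x. (\<Sum>t<m. h t x) - real m * f x)"
      unfolding L2_dist_def by (simp only: L2_seminorm_scale) simp
    also have "L2_seminorm M (\<lambda>x. (\<Sum>t<m. h t x) - real m * f x) \<le> sqrt (real m * \<sigma>\<^sup>2)"
      using real_sqrt_le_mono[OF h(2)] by simp
    also have "sqrt (real m * \<sigma>\<^sup>2) = sqrt (real m) * \<sigma>"
      using \<sigma>(2) by (simp add: real_sqrt_mult)
    also have "(1 / real m) * (sqrt (real m) * \<sigma>) = \<sigma> / sqrt (real m)"
      using m by (simp add: field_simps flip: power2_eq_square)
    finally have "L2_dist M (avg h') f \<le> \<sigma> / sqrt (real m)"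
      using \<open>avg h' = avg h\<close> m by (simp add: divide_right_mono)
    then show ?thesis using h' unfolding f_def by blast
  qed
  ultimately show ?thesis by (intro exI[of _ "avg ` H"]) simp
qed

section \<open>Nets in Euclidean balls\<close>

lemma sum_two_sided_geometric:
  "(\<Sum>z\<in>{- int n..int n}. (1 / 2) ^ nat \<bar>z\<bar>) = 3 - 2 * (1 / 2 :: real) ^ n"
proof (induction n)
  case (Suc n)
  have "{- int (Suc n)..int (Suc n)} = insert (int (Suc n)) (insert (- int (Suc n)) {- int n..int n})"
    by auto
  then show ?case using Suc by (simp add: nat_add_distrib)
qed simp

text \<open>
  Give each lattice point \<open>z\<close> the weight \<open>2^(-\<Sum>\<bar>z i\<bar>)\<close>. The points counted have weight at least
  \<open>2^(-n)\<close>, and the total weight factorises into one-dimensional sums bounded by \<open>3\<close>.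
\<close>

lemma card_lattice_l1_ball:
  assumes I: "finite I"
  shows "real (card {z \<in> PiE I (\<lambda>_. {- int n..int n}). (\<Sum>i\<in>I. nat \<bar>z i\<bar>) \<le> n}) \<le> 2 ^ n * 3 ^ card I"
proof -
  let ?P = "PiE I (\<lambda>_. {- int n..int n})"
  let ?Z = "{z \<in> ?P. (\<Sum>i\<in>I. nat \<bar>z i\<bar>) \<le> n}"
  have fin: "finite ?P" by (intro finite_PiE I) auto
  have "real (card ?Z) * (1 / 2) ^ n = (\<Sum>z\<in>?Z. (1 / 2) ^ n)" by simp
  also have "\<dots> \<le> (\<Sum>z\<in>?Z. (1 / 2) ^ (\<Sum>i\<in>I. nat \<bar>z i\<bar>))"
    by (intro sum_mono power_decreasing) auto
  also have "\<dots> \<le> (\<Sum>z\<in>?P. (1 / 2) ^ (\<Sum>i\<in>I. nat \<bar>z i\<bar>))"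
    by (intro sum_mono2 fin) auto
  also have "\<dots> = (\<Sum>z\<in>?P. \<Prod>i\<in>I. (1 / 2) ^ nat \<bar>z i\<bar>)"
    by (simp add: power_sum)
  also have "\<dots> = (\<Prod>i\<in>I. \<Sum>y\<in>{- int n..int n}. (1 / 2) ^ nat \<bar>y\<bar>)"
    by (rule prod_sum_PiE[symmetric]) (auto simp: I)
  also have "\<dots> \<le> (\<Prod>i\<in>I. 3)"
    by (intro prod_mono conjI sum_nonneg) (simp_all add: sum_two_sided_geometric)
  finally show ?thesis by (simp add: field_simps power_one_over)
qed

lemma int_truncation:
  fixes y :: real
  shows "\<exists>z::int. \<bar>real_of_int z\<bar> \<le> \<bar>y\<bar> \<and> \<bar>y - real_of_int z\<bar> \<le> 1"
proof (cases "y \<ge> 0")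
  case True
  then have "0 \<le> real_of_int \<lfloor>y\<rfloor>" by simp
  then show ?thesis using True floor_correct[of y] by (intro exI[of _ "\<lfloor>y\<rfloor>"] conjI; linarith)
next
  case False
  then have "real_of_int \<lceil>y\<rceil> \<le> 0" by simp
  then show ?thesis using False ceiling_correct[of y] by (intro exI[of _ "\<lceil>y\<rceil>"] conjI; linarith)
qed

text \<open>
  Round every coordinate towards zero to a multiple of \<open>\<delta>\<close>. The mesh \<open>\<delta>\<close> is chosen such that the
  rounding error is at most \<open>r / 4\<close> in the Euclidean norm. The rounded point is \<open>\<delta> z\<close> with
  integers \<open>z i\<close> satisfying \<open>\<Sum>\<bar>z i\<bar> \<le> \<Sum>(z i)\<^sup>2 \<le> (r / \<delta>)\<^sup>2 = 16 (card I + 1)\<close>, so the number of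
  possible \<open>z\<close> is exponential in the dimension only.
\<close>

lemma lattice_net:
  assumes I: "finite I" and r: "r > 0"
  defines "\<delta> \<equiv> r / (4 * sqrt (real (card I) + 1))"
  shows "\<exists>Z :: ('i \<Rightarrow> int) set. finite Z \<and> real (card Z) \<le> 2 ^ (18 * (card I + 1)) \<and>
    (\<forall>y. (\<Sum>i\<in>I. (y i)\<^sup>2) \<le> r\<^sup>2 \<longrightarrow>
       (\<exists>z\<in>Z. (\<Sum>i\<in>I. (\<delta> * real_of_int (z i) - y i)\<^sup>2) \<le> (r / 4)\<^sup>2))"
proof -
  define D where "D = card I"
  define n where "n = 16 * (D + 1)"
  let ?Z = "{z \<in> PiE I (\<lambda>_. {- int n..int n}). (\<Sum>i\<in>I. nat \<bar>z i\<bar>) \<le> n}"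
  have \<delta>: "\<delta> > 0" using r by (simp add: \<delta>_def add_nonneg_pos)
  have \<delta>2: "\<delta>\<^sup>2 * (16 * (real D + 1)) = r\<^sup>2"
    by (simp add: \<delta>_def D_def power_divide power_mult_distrib)
  have "finite ?Z" by (rule finite_subset[of _ "PiE I (\<lambda>_. {- int n..int n})"]) (auto intro!: finite_PiE I)
  moreover have "real (card ?Z) \<le> 2 ^ (18 * (D + 1))"
  proof -
    have "(3 :: real) ^ D \<le> 4 ^ D" by (intro power_mono) auto
    also have "\<dots> = 2 ^ (2 * D)" by (simp add: power_mult)
    also have "\<dots> \<le> 2 ^ (2 * (D + 1))" by (intro power_increasing) auto
    finally have "2 ^ n * 3 ^ D \<le> (2 :: real) ^ n * 2 ^ (2 * (D + 1))"
      by (intro mult_left_mono) auto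
    also have "\<dots> = 2 ^ (18 * (D + 1))"
      unfolding power_add[symmetric] n_def by (intro arg_cong[where f = "(^) 2"]) simp
    finally show ?thesis
      using card_lattice_l1_ball[OF I, of n] unfolding D_def by linarith
  qed
  moreover have "\<exists>z\<in>?Z. (\<Sum>i\<in>I. (\<delta> * real_of_int (z i) - y i)\<^sup>2) \<le> (r / 4)\<^sup>2"
    if y: "(\<Sum>i\<in>I. (y i)\<^sup>2) \<le> r\<^sup>2" for y
  proof -
    have "\<forall>i. \<exists>z::int. \<bar>real_of_int z\<bar> \<le> \<bar>y i / \<delta>\<bar> \<and> \<bar>y i / \<delta> - real_of_int z\<bar> \<le> 1"
      using int_truncation by blast
    then obtain z0 :: "'i \<Rightarrow> int" where z0: "\<And>i. \<bar>real_of_int (z0 i)\<bar> \<le> \<bar>y i / \<delta>\<bar>"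
      "\<And>i. \<bar>y i / \<delta> - real_of_int (z0 i)\<bar> \<le> 1" by metis
    define z where "z = restrict z0 I"
    have z: "z i = z0 i" if "i \<in> I" for i using that by (simp add: z_def)
    have "real (\<Sum>i\<in>I. nat \<bar>z i\<bar>) = (\<Sum>i\<in>I. \<bar>real_of_int (z0 i)\<bar>)"
      unfolding of_nat_sum by (intro sum.cong) (auto simp: z)
    also have "\<dots> \<le> (\<Sum>i\<in>I. (y i / \<delta>)\<^sup>2)"
    proof (rule sum_mono)
      fix i
      have "\<bar>z0 i\<bar> * 1 \<le> \<bar>z0 i\<bar> * \<bar>z0 i\<bar>" by (cases "z0 i = 0"; (simp; fail)?; intro mult_left_mono) auto
      then have "\<bar>real_of_int (z0 i)\<bar> \<le> \<bar>real_of_int (z0 i)\<bar>\<^sup>2"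
        unfolding power2_eq_square of_int_abs[symmetric] of_int_mult[symmetric] of_int_le_iff by simp
      also have "\<dots> \<le> \<bar>y i / \<delta>\<bar>\<^sup>2" by (intro power_mono z0) auto
      finally show "\<bar>real_of_int (z0 i)\<bar> \<le> (y i / \<delta>)\<^sup>2" by (simp only: power2_abs)
    qed
    also have "\<dots> = (\<Sum>i\<in>I. (y i)\<^sup>2) / \<delta>\<^sup>2" by (simp add: power_divide sum_divide_distrib)
    also have "\<dots> \<le> r\<^sup>2 / \<delta>\<^sup>2" using y by (intro divide_right_mono) auto
    also have "\<dots> = real n" using \<delta> \<delta>2 by (simp add: field_simps n_def)
    finally have le: "(\<Sum>i\<in>I. nat \<bar>z i\<bar>) \<le> n" by linarith
    have "z i \<in> {- int n..int n}" if "i \<in> I" for i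
    proof -
      have "nat \<bar>z i\<bar> \<le> n"
        using member_le_sum[of i I "\<lambda>i. nat \<bar>z i\<bar>"] that I le by auto
      then show ?thesis by auto
    qed
    then have "z \<in> PiE I (\<lambda>_. {- int n..int n})"
      unfolding z_def by (intro restrict_PiE_iff[THEN iffD2]) auto
    then have zZ: "z \<in> ?Z" using le by simp
    have "(\<Sum>i\<in>I. (\<delta> * real_of_int (z i) - y i)\<^sup>2) \<le> (\<Sum>i\<in>I. \<delta>\<^sup>2)"
    proof (rule sum_mono)
      fix i assume i: "i \<in> I"
      have "\<bar>\<delta> * real_of_int (z i) - y i\<bar> = \<delta> * \<bar>y i / \<delta> - real_of_int (z0 i)\<bar>"
        using \<delta> z[OF i] by (simp add: abs_mult_pos'[symmetric] abs_minus_commute field_simps)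
      also have "\<dots> \<le> \<delta> * 1" using \<delta> z0(2) by (intro mult_left_mono) auto
      finally have "\<bar>\<delta> * real_of_int (z i) - y i\<bar>\<^sup>2 \<le> \<delta>\<^sup>2" by (intro power_mono) auto
      then show "(\<delta> * real_of_int (z i) - y i)\<^sup>2 \<le> \<delta>\<^sup>2" by simp
    qed
    also have "\<dots> \<le> (r / 4)\<^sup>2"
    proof -
      have "real D * \<delta>\<^sup>2 * 16 \<le> r\<^sup>2"
        using \<delta>2 by (simp add: algebra_simps flip: \<delta>2)
      then show ?thesis by (simp add: D_def power_divide)
    qed
    finally show ?thesis using zZ by blast
  qed
  ultimately show ?thesis unfolding D_def by (intro exI[of _ ?Z]) simp
qed

section \<open>Halving the covering radius\<close>

definition abs_hull :: "'j set \<Rightarrow> ('j \<Rightarrow> 'a \<Rightarrow> real) \<Rightarrow> ('a \<Rightarrow> real) set" where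
  "abs_hull J g = {(\<lambda>x. \<Sum>a\<in>A. \<beta> a * g a x) | A \<beta>. finite A \<and> A \<subseteq> J \<and> (\<Sum>a\<in>A. \<bar>\<beta> a\<bar>) \<le> 1}"

text \<open>
  A real upper bound in place of the covering number itself, so that the recursion over the scales
  can multiply bounds freely.
\<close>

definition coverable :: "'a measure \<Rightarrow> real \<Rightarrow> ('a \<Rightarrow> real) set \<Rightarrow> real \<Rightarrow> bool" where
  "coverable M r T B \<longleftrightarrow>
     (\<exists>C. finite C \<and> C \<subseteq> L2_fun M \<and> (\<forall>f\<in>T. \<exists>c\<in>C. L2_dist M c f < r) \<and> real (card C) \<le> B)"

lemma abs_hull_L2: "(\<And>a. a \<in> J \<Longrightarrow> g a \<in> L2_fun M) \<Longrightarrow> abs_hull J g \<subseteq> L2_fun M"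
  unfolding abs_hull_def by (auto intro!: L2_fun_sum)

lemma coverable_abs_hull_2:
  assumes g: "\<And>a. a \<in> J \<Longrightarrow> g a \<in> L2_fun M" "\<And>a. a \<in> J \<Longrightarrow> L2_seminorm M (g a) \<le> 1"
  shows "coverable M 2 (abs_hull J g) 1"
proof -
  have "L2_dist M (\<lambda>x. 0) f < 2" if f: "f \<in> abs_hull J g" for f
  proof -
    obtain A \<beta> where A: "finite A" "A \<subseteq> J" "(\<Sum>a\<in>A. \<bar>\<beta> a\<bar>) \<le> 1" and f: "f = (\<lambda>x. \<Sum>a\<in>A. \<beta> a * g a x)"
      using f unfolding abs_hull_def by auto
    have "L2_seminorm M f \<le> (\<Sum>a\<in>A. \<bar>\<beta> a\<bar> * L2_seminorm M (g a))"
      unfolding f using A(2) g(1) by (intro L2_seminorm_sum) auto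
    also have "\<dots> \<le> (\<Sum>a\<in>A. \<bar>\<beta> a\<bar> * 1)"
      using A(2) g(2) by (intro sum_mono mult_left_mono) auto
    finally have "L2_seminorm M f \<le> 1" using A(3) by simp
    then show ?thesis by (simp add: L2_dist_def L2_seminorm_uminus)
  qed
  then show ?thesis
    unfolding coverable_def by (intro exI[of _ "{\<lambda>x. 0}"]) auto
qed

lemma coverable_subset: "coverable M r T B \<Longrightarrow> S \<subseteq> T \<Longrightarrow> B \<le> B' \<Longrightarrow> coverable M r S B'"
proof -
  assume cov: "coverable M r T B" and S: "S \<subseteq> T" and B: "B \<le> B'"
  obtain C where C: "finite C" "C \<subseteq> L2_fun M" "\<forall>f\<in>T. \<exists>c\<in>C. L2_dist M c f < r" "real (card C) \<le> B"
    using cov unfolding coverable_def by (elim exE conjE)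
  have "\<forall>f\<in>S. \<exists>c\<in>C. L2_dist M c f < r" using C(3) S by (meson subsetD)
  moreover have "real (card C) \<le> B'" using C(4) B by linarith
  ultimately show ?thesis unfolding coverable_def using C(1,2) by (intro exI[of _ C] conjI)
qed

text \<open>
  A new centre is assembled from an old centre \<open>c\<close> with \<open>f\<close> in its ball, a lattice
  point \<open>z\<close> that corrects the projection of \<open>c\<close> to that of \<open>f\<close> up to \<open>r / 4\<close>, and a Maurey average
  \<open>k\<close> that replaces the residual of \<open>f\<close>. The residual is first moved to generators in the net
  \<open>J0\<close> at the price of \<open>r / 16\<close>, and then approximated up to \<open>r / 8\<close>. The projection of \<open>f - c\<close> has
  norm below \<open>r\<close> since projections are contractions; this is why the lattice point costs a factor
  exponential in \<open>card I\<close>, with no logarithm of \<open>r\<close>.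
\<close>

lemma coverable_halve:
  fixes g :: "'j \<Rightarrow> 'a \<Rightarrow> real" and e :: "'i \<Rightarrow> 'a \<Rightarrow> real"
  assumes gL: "\<And>a. a \<in> J \<Longrightarrow> g a \<in> L2_fun M"
    and J0: "finite J0" "J0 \<subseteq> J" and near: "\<And>a. a \<in> J \<Longrightarrow> \<exists>b\<in>J0. L2_dist M (g a) (g b) \<le> r / 16"
    and e: "orthosys M I e" and I: "finite I"
    and \<sigma>: "\<And>a. a \<in> J \<Longrightarrow> L2_seminorm M (residual M I e (g a)) \<le> \<sigma>" "0 \<le> \<sigma>"
    and m: "m \<ge> 1" "\<sigma> \<le> r / 8 * sqrt (real m)" and r: "r > 0"
    and cov: "coverable M r (abs_hull J g) B"
  shows "coverable M (r / 2) (abs_hull J g) (B * (2 ^ (18 * (card I + 1)) * (2 * real (card J0) + 1) ^ m))"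
proof -
  let ?R = "residual M I e"
  have eL: "\<And>i. i \<in> I \<Longrightarrow> e i \<in> L2_fun M" using e by (simp add: orthosys_def)
  obtain C where C: "finite C" "C \<subseteq> L2_fun M" "\<forall>f\<in>abs_hull J g. \<exists>c\<in>C. L2_dist M c f < r"
    "real (card C) \<le> B"
    using cov unfolding coverable_def by (elim exE conjE)
  define \<delta> where "\<delta> = r / (4 * sqrt (real (card I) + 1))"
  obtain Z :: "('i \<Rightarrow> int) set" where Z: "finite Z" "real (card Z) \<le> 2 ^ (18 * (card I + 1))"
    "\<forall>y. (\<Sum>i\<in>I. (y i)\<^sup>2) \<le> r\<^sup>2 \<longrightarrow>
       (\<exists>z\<in>Z. (\<Sum>i\<in>I. (\<delta> * real_of_int (z i) - y i)\<^sup>2) \<le> (r / 4)\<^sup>2)"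
    using lattice_net[OF I r] unfolding \<delta>_def by (elim exE conjE)
  define G where "G = insert (\<lambda>x. 0) ((\<lambda>b. ?R (g b)) ` J0 \<union> (\<lambda>b x. - ?R (g b) x) ` J0)"
  have RL: "?R (g b) \<in> L2_fun M" if "b \<in> J" for b
    by (rule residual_L2[OF e gL[OF that]])
  have Gfin: "finite G" using J0 by (simp add: G_def)
  have G0: "(\<lambda>x. 0) \<in> G" by (simp add: G_def)
  have Gneg: "(\<lambda>x. - h x) \<in> G" if "h \<in> G" for h
    using that by (auto simp: G_def)
  have GL: "G \<subseteq> L2_fun M"
    using RL J0(2) by (auto simp: G_def intro!: L2_fun_uminus)
  have G\<sigma>: "L2_seminorm M h \<le> \<sigma>" if "h \<in> G" for h
    using that \<sigma> J0(2) by (auto simp: G_def L2_seminorm_uminus)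
  have Gcard: "card G \<le> 2 * card J0 + 1"
  proof -
    have "card G \<le> Suc (card ((\<lambda>b. ?R (g b)) ` J0 \<union> (\<lambda>b x. - ?R (g b) x) ` J0))"
      unfolding G_def by (rule card_insert_le_m1) simp_all
    also have "\<dots> \<le> Suc (card ((\<lambda>b. ?R (g b)) ` J0) + card ((\<lambda>b x. - ?R (g b) x) ` J0))"
      using card_Un_le by simp
    also have "\<dots> \<le> Suc (card J0 + card J0)"
      using card_image_le[OF J0(1)] by (intro Suc_le_mono[THEN iffD2] add_mono) auto
    finally show ?thesis by simp
  qed
  have "\<exists>K. finite K \<and> K \<subseteq> L2_fun M \<and> card K \<le> card G ^ m \<and>
    (\<forall>A \<beta> h. finite A \<longrightarrow> h ` A \<subseteq> G \<longrightarrow> (\<Sum>a\<in>A. \<bar>\<beta> a\<bar>) \<le> 1 \<longrightarrow>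
       (\<exists>k\<in>K. L2_dist M k (\<lambda>x. \<Sum>a\<in>(A :: 'j set). \<beta> a * h a x) \<le> \<sigma> / sqrt (real m)))"
    by (rule maurey_cover[OF Gfin G0 _ GL m(1) _ \<sigma>(2)]) (erule Gneg, erule G\<sigma>)
  then obtain K where K: "finite K" "K \<subseteq> L2_fun M" "card K \<le> card G ^ m"
    "\<forall>A \<beta> h. finite A \<longrightarrow> h ` A \<subseteq> G \<longrightarrow> (\<Sum>a\<in>A. \<bar>\<beta> a\<bar>) \<le> 1 \<longrightarrow>
       (\<exists>k\<in>K. L2_dist M k (\<lambda>x. \<Sum>a\<in>(A :: 'j set). \<beta> a * h a x) \<le> \<sigma> / sqrt (real m))"
    by (elim exE conjE)
  define ctr where "ctr = (\<lambda>(c, z, k) x. (c x - ?R c x) + ((\<Sum>i\<in>I. (\<delta> * real_of_int (z i)) * e i x) + k x))"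
  let ?C = "ctr ` (C \<times> Z \<times> K)"
  have fin: "finite ?C" using C Z K by simp
  have sub: "?C \<subseteq> L2_fun M"
  proof
    fix h assume "h \<in> ?C"
    then obtain c z k where h: "h = ctr (c, z, k)" "c \<in> C" "k \<in> K" by auto
    have cL: "c \<in> L2_fun M" and kL: "k \<in> L2_fun M" using h C K by auto
    show "h \<in> L2_fun M"
      unfolding h(1) ctr_def split
      by (rule L2_fun_add[OF L2_fun_diff[OF cL residual_L2[OF e cL]] L2_fun_add[OF L2_fun_sum[OF eL] kL]])
  qed
  have near_ctr: "\<exists>h\<in>?C. L2_dist M h f < r / 2" if fT: "f \<in> abs_hull J g" for f
  proof -
    obtain A \<beta> where A: "finite A" "A \<subseteq> J" "(\<Sum>a\<in>A. \<bar>\<beta> a\<bar>) \<le> 1" and f: "f = (\<lambda>x. \<Sum>a\<in>A. \<beta> a * g a x)"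
      using fT unfolding abs_hull_def by auto
    have gA: "g a \<in> L2_fun M" if "a \<in> A" for a using A(2) gL that by auto
    have fL: "f \<in> L2_fun M" unfolding f by (intro L2_fun_sum gA)
    obtain c where c: "c \<in> C" "L2_dist M c f < r" using C(3) fT by blast
    have cL: "c \<in> L2_fun M" using c C by auto
    have fcL: "(\<lambda>x. f x - c x) \<in> L2_fun M" by (rule L2_fun_diff[OF fL cL])
    define y where "y = (\<lambda>i. ip M (\<lambda>x. f x - c x) (e i))"
    have "(\<Sum>i\<in>I. (y i)\<^sup>2) \<le> (L2_seminorm M (\<lambda>x. f x - c x))\<^sup>2"
      unfolding y_def by (rule residual_contraction(2)[OF e I fcL])
    also have "\<dots> \<le> r\<^sup>2"
      using c(2)[unfolded L2_dist_commute[of M c f]] unfolding L2_dist_def by (intro power_mono) auto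
    finally obtain z where z: "z \<in> Z" "(\<Sum>i\<in>I. (\<delta> * real_of_int (z i) - y i)\<^sup>2) \<le> (r / 4)\<^sup>2"
      using Z(3) by blast
    have "\<forall>a\<in>A. \<exists>b. b \<in> J0 \<and> L2_dist M (g a) (g b) \<le> r / 16"
      using near A(2) by blast
    then obtain p where p: "\<And>a. a \<in> A \<Longrightarrow> p a \<in> J0" "\<And>a. a \<in> A \<Longrightarrow> L2_dist M (g a) (g (p a)) \<le> r / 16"
      by metis
    have gp: "g (p a) \<in> L2_fun M" if "a \<in> A" for a using p(1)[OF that] J0(2) gL by auto
    define f' where "f' = (\<lambda>x. \<Sum>a\<in>A. \<beta> a * g (p a) x)"
    have f'L: "f' \<in> L2_fun M" unfolding f'_def by (intro L2_fun_sum gp)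
    have Rf': "?R f' = (\<lambda>x. \<Sum>a\<in>A. \<beta> a * ?R (g (p a)) x)"
      unfolding f'_def by (rule residual_sum[OF e gp])
    have "(\<lambda>a. ?R (g (p a))) ` A \<subseteq> G" using p(1) by (auto simp: G_def)
    from K(4)[rule_format, OF A(1) this A(3)] obtain k where k: "k \<in> K" "L2_dist M k (?R f') \<le> \<sigma> / sqrt (real m)"
      unfolding Rf' by blast
    have kL: "k \<in> L2_fun M" using k K by auto
    have k': "L2_dist M k (?R f') \<le> r / 8"
    proof -
      have "\<sigma> / sqrt (real m) \<le> r / 8" using m by (simp add: field_simps)
      then show ?thesis using k(2) by linarith
    qed
    have ff': "L2_dist M (?R f') (?R f) \<le> r / 16"
    proof -
      have "L2_dist M (?R f') (?R f) = L2_seminorm M (?R (\<lambda>x. f' x - f x))"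
        unfolding L2_dist_def by (simp only: residual_diff[OF e f'L fL])
      also have "\<dots> \<le> L2_seminorm M (\<lambda>x. f' x - f x)"
        by (rule residual_contraction(1)[OF e I L2_fun_diff[OF f'L fL]])
      also have "(\<lambda>x. f' x - f x) = (\<lambda>x. \<Sum>a\<in>A. \<beta> a * (g (p a) x - g a x))"
        unfolding f'_def f by (simp add: right_diff_distrib sum_subtractf)
      also have "L2_seminorm M \<dots> \<le> (\<Sum>a\<in>A. \<bar>\<beta> a\<bar> * L2_seminorm M (\<lambda>x. g (p a) x - g a x))"
        by (intro L2_seminorm_sum L2_fun_diff gp gA)
      also have "\<dots> \<le> (\<Sum>a\<in>A. \<bar>\<beta> a\<bar> * (r / 16))"
        using p(2)[unfolded L2_dist_commute[of M "g _" "g (p _)"]] unfolding L2_dist_def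
        by (intro sum_mono mult_left_mono) auto
      also have "\<dots> \<le> 1 * (r / 16)"
        unfolding sum_distrib_right[symmetric] using A(3) r by (intro mult_right_mono) auto
      finally show ?thesis by simp
    qed
    define q where "q = (\<lambda>x. \<Sum>i\<in>I. (\<delta> * real_of_int (z i) - y i) * e i x)"
    have qL: "q \<in> L2_fun M" unfolding q_def by (intro L2_fun_sum eL)
    have q: "L2_seminorm M q \<le> r / 4"
    proof (rule power2_le_imp_le)
      show "(L2_seminorm M q)\<^sup>2 \<le> (r / 4)\<^sup>2"
        using orthosys_sum_seminorm[OF e I] z(2) unfolding q_def by (rule order_trans)
    qed (use r in simp)
    define s where "s = (\<lambda>x. (k x - ?R f' x) + (?R f' x - ?R f x))"
    have sL: "(\<lambda>x. k x - ?R f' x) \<in> L2_fun M" "(\<lambda>x. ?R f' x - ?R f x) \<in> L2_fun M"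
      by (intro L2_fun_diff kL residual_L2[OF e] f'L fL)+
    have s: "L2_seminorm M s \<le> r / 8 + r / 16"
      unfolding s_def using L2_seminorm_triangle[OF sL] k' ff' unfolding L2_dist_def by linarith
    \<comment> \<open>\<open>ctr (c, z, k)\<close> keeps only the projection of \<open>c\<close>, so compare it with \<open>f\<close> through the projection of \<open>f - c\<close>.\<close>
    have Rfc: "?R f x - ?R c x = f x - c x - (\<Sum>i\<in>I. y i * e i x)" for x
      using fun_cong[OF residual_diff[OF e fL cL], of x] unfolding y_def by (simp add: residual_def)
    have "(\<lambda>x. ctr (c, z, k) x - f x) = (\<lambda>x. q x + s x)"
    proof
      fix x
      have "q x = (\<Sum>i\<in>I. (\<delta> * real_of_int (z i)) * e i x) - (\<Sum>i\<in>I. y i * e i x)"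
        unfolding q_def by (simp add: left_diff_distrib sum_subtractf)
      then show "ctr (c, z, k) x - f x = q x + s x"
        unfolding ctr_def split s_def using Rfc[of x] by linarith
    qed
    then have "L2_dist M (ctr (c, z, k)) f = L2_seminorm M (\<lambda>x. q x + s x)"
      by (simp add: L2_dist_def)
    also have "\<dots> \<le> L2_seminorm M q + L2_seminorm M s"
      using qL L2_fun_add[OF sL] unfolding s_def by (rule L2_seminorm_triangle)
    also have "\<dots> < r / 2" using q s r by linarith
    finally show ?thesis using c(1) z(1) k(1) by blast
  qed
  have card: "real (card ?C) \<le> B * (2 ^ (18 * (card I + 1)) * (2 * real (card J0) + 1) ^ m)"
  proof -
    have "card ?C \<le> card (C \<times> Z \<times> K)" using C Z K by (intro card_image_le) auto
    then have "real (card ?C) \<le> real (card C) * (real (card Z) * real (card K))"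
      by (simp add: card_cartesian_product flip: of_nat_mult)
    also have "\<dots> \<le> B * (2 ^ (18 * (card I + 1)) * (2 * real (card J0) + 1) ^ m)"
    proof (intro mult_mono)
      have "card K \<le> (2 * card J0 + 1) ^ m"
        using K(3) power_mono[OF Gcard, of m] by simp
      then have "real (card K) \<le> real ((2 * card J0 + 1) ^ m)" by (rule of_nat_mono)
      then show "real (card K) \<le> (2 * real (card J0) + 1) ^ m" by (simp add: add.commute)
      show "0 \<le> B" using C(4) by linarith
    qed (use C Z in auto)
    finally show ?thesis .
  qed
  show ?thesis unfolding coverable_def by (intro exI[of _ ?C] conjI ballI fin sub near_ctr card)
qed

section \<open>Tensor products\<close>

definition tensor :: "nat \<Rightarrow> (nat \<Rightarrow> 'a \<Rightarrow> real) \<Rightarrow> (nat \<Rightarrow> 'a) \<Rightarrow> real" where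
  "tensor d f = (\<lambda>u. \<Prod>l<d. f l (u l))"

lemma tensor_cong: "(\<And>l. l < d \<Longrightarrow> f l = g l) \<Longrightarrow> tensor d f = tensor d g"
  unfolding tensor_def by (intro ext prod.cong) auto

lemma integral_tensor:
  assumes "sigma_finite_measure \<mu>" "\<And>l. l < d \<Longrightarrow> integrable \<mu> (f l)"
  shows "integrable (product_power \<mu> d) (tensor d f)"
    and "integral\<^sup>L (product_power \<mu> d) (tensor d f) = (\<Prod>l<d. integral\<^sup>L \<mu> (f l))"
proof -
  interpret product_sigma_finite "\<lambda>_. \<mu>"
    by (simp add: product_sigma_finite_def assms(1))
  show "integrable (product_power \<mu> d) (tensor d f)"
    unfolding tensor_def using assms(2) by (intro product_integrable_prod) auto
  show "integral\<^sup>L (product_power \<mu> d) (tensor d f) = (\<Prod>l<d. integral\<^sup>L \<mu> (f l))"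
    unfolding tensor_def using assms(2) by (intro product_integral_prod) auto
qed

lemma tensor_L2:
  assumes "sigma_finite_measure \<mu>" "\<And>l. l < d \<Longrightarrow> f l \<in> L2_fun \<mu>"
  shows "tensor d f \<in> L2_fun (product_power \<mu> d)"
proof -
  have "tensor d f \<in> borel_measurable (product_power \<mu> d)"
    unfolding tensor_def
  proof (rule borel_measurable_prod)
    fix l assume l: "l \<in> {..<d}"
    have "f l \<in> borel_measurable \<mu>" using assms(2) l by (simp add: L2_fun_def)
    with measurable_component_singleton[OF l]
    show "(\<lambda>u. f l (u l)) \<in> borel_measurable (product_power \<mu> d)"
      by (rule measurable_compose)
  qed
  moreover have "integrable (product_power \<mu> d) (tensor d (\<lambda>l x. (f l x)\<^sup>2))"
    using assms by (intro integral_tensor) (auto simp: L2_fun_def)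
  ultimately show ?thesis
    by (simp add: L2_fun_def tensor_def prod_power_distrib)
qed

lemma ip_tensor:
  assumes "sigma_finite_measure \<mu>" "\<And>l. l < d \<Longrightarrow> f l \<in> L2_fun \<mu>" "\<And>l. l < d \<Longrightarrow> g l \<in> L2_fun \<mu>"
  shows "ip (product_power \<mu> d) (tensor d f) (tensor d g) = (\<Prod>l<d. ip \<mu> (f l) (g l))"
proof -
  have "(\<lambda>u. tensor d f u * tensor d g u) = tensor d (\<lambda>l x. f l x * g l x)"
    by (simp add: tensor_def prod.distrib)
  then show ?thesis
    unfolding ip_def using assms
    by (simp add: integral_tensor(2) L2_fun_mult_integrable)
qed

lemma L2_seminorm_tensor:
  assumes "sigma_finite_measure \<mu>" "\<And>l. l < d \<Longrightarrow> f l \<in> L2_fun \<mu>"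
  shows "L2_seminorm (product_power \<mu> d) (tensor d f) = (\<Prod>l<d. L2_seminorm \<mu> (f l))"
proof -
  have "L2_seminorm (product_power \<mu> d) (tensor d f) = sqrt ((\<Prod>l<d. L2_seminorm \<mu> (f l))\<^sup>2)"
    unfolding L2_seminorm_eq_ip[of "product_power \<mu> d"] prod_power_distrib L2_seminorm_sq
    using ip_tensor[of \<mu> d f f, OF assms assms(2)] by simp
  also have "\<dots> = (\<Prod>l<d. L2_seminorm \<mu> (f l))"
    by (simp add: prod_nonneg)
  finally show ?thesis .
qed

text \<open>
  Exchange the factors one at a time: consecutive hybrids differ by a product that has
  \<open>f j - g j\<close> in one place and factors of norm at most \<open>1\<close> elsewhere.
\<close>

lemma tensor_lipschitz:
  assumes \<mu>: "sigma_finite_measure \<mu>"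
    and f: "\<And>l. l < d \<Longrightarrow> f l \<in> L2_fun \<mu>" "\<And>l. l < d \<Longrightarrow> L2_seminorm \<mu> (f l) \<le> 1"
    and g: "\<And>l. l < d \<Longrightarrow> g l \<in> L2_fun \<mu>" "\<And>l. l < d \<Longrightarrow> L2_seminorm \<mu> (g l) \<le> 1"
  shows "L2_dist (product_power \<mu> d) (tensor d f) (tensor d g) \<le> (\<Sum>l<d. L2_dist \<mu> (f l) (g l))"
proof -
  let ?P = "product_power \<mu> d"
  define h where "h = (\<lambda>j l. if l < j then f l else g l)"
  have hL: "h j l \<in> L2_fun \<mu>" "L2_seminorm \<mu> (h j l) \<le> 1" if "l < d" for j l
    using f g that by (auto simp: h_def)
  have thL: "tensor d (h j) \<in> L2_fun ?P" for j
    by (rule tensor_L2[OF \<mu> hL(1)])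
  have "j \<le> d \<Longrightarrow> L2_dist ?P (tensor d (h j)) (tensor d (h 0)) \<le> (\<Sum>l<j. L2_dist \<mu> (f l) (g l))" for j
  proof (induction j)
    case 0
    then show ?case by (simp add: L2_dist_def)
  next
    case (Suc j)
    then have j: "j < d" by simp
    define k where "k = (h j)(j := (\<lambda>x. f j x - g j x))"
    have kL: "k l \<in> L2_fun \<mu>" if "l < d" for l
      using that hL f g j by (auto simp: k_def L2_fun_diff)
    have eq: "tensor d (h (Suc j)) u - tensor d (h j) u = tensor d k u" for u
    proof -
      have jd: "j \<in> {..<d}" using j by simp
      have split: "tensor d w u = w j (u j) * (\<Prod>l\<in>{..<d} - {j}. w l (u l))" for w
        unfolding tensor_def by (rule prod.remove[OF _ jd]) simp
      have 1: "(\<Prod>l\<in>{..<d} - {j}. h (Suc j) l (u l)) = (\<Prod>l\<in>{..<d} - {j}. h j l (u l))"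
        by (intro prod.cong) (auto simp: h_def)
      have 2: "(\<Prod>l\<in>{..<d} - {j}. k l (u l)) = (\<Prod>l\<in>{..<d} - {j}. h j l (u l))"
        by (intro prod.cong) (auto simp: k_def)
      have "h (Suc j) j = f j" "h j j = g j" "k j = (\<lambda>x. f j x - g j x)"
        by (simp_all add: h_def k_def)
      then show ?thesis
        unfolding split[of "h (Suc j)"] split[of "h j"] split[of k] 1 2
        by (simp add: left_diff_distrib)
    qed
    have "L2_dist ?P (tensor d (h (Suc j))) (tensor d (h j)) = (\<Prod>l<d. L2_seminorm \<mu> (k l))"
      unfolding L2_dist_def eq by (rule L2_seminorm_tensor[OF \<mu> kL])
    also have "\<dots> = L2_dist \<mu> (f j) (g j) * (\<Prod>l\<in>{..<d} - {j}. L2_seminorm \<mu> (k l))"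
      using j by (subst prod.remove[of _ j]) (auto simp: k_def L2_dist_def)
    also have "\<dots> \<le> L2_dist \<mu> (f j) (g j) * 1"
      using hL(2) by (intro mult_left_mono prod_le_1) (auto simp: k_def L2_dist_def)
    finally show ?case
      using Suc.IH j L2_dist_triangle[OF thL[of "Suc j"] thL[of j] thL[of 0]] by simp
  qed
  from this[of d] show ?thesis
    using tensor_cong[of d "h d" f] tensor_cong[of d "h 0" g] by (simp add: h_def)
qed

lemma orthosys_tensor:
  assumes \<mu>: "sigma_finite_measure \<mu>" and e: "orthosys \<mu> UNIV e" and I: "I \<subseteq> extensional {..<d}"
  shows "orthosys (product_power \<mu> d) I (\<lambda>i. tensor d (\<lambda>l. e (i l)))"
proof -
  have eL: "e n \<in> L2_fun \<mu>" for n using e by (simp add: orthosys_def)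
  have ip: "ip (product_power \<mu> d) (tensor d (\<lambda>l. e (i l))) (tensor d (\<lambda>l. e (j l)))
      = (\<Prod>l<d. ip \<mu> (e (i l)) (e (j l)))" for i j
    by (rule ip_tensor[OF \<mu> eL eL])
  have "(\<Prod>l<d. ip \<mu> (e (i l)) (e (j l))) = 0" if "i \<in> I" "j \<in> I" "i \<noteq> j" for i j
  proof -
    have "\<exists>l<d. i l \<noteq> j l"
    proof (rule ccontr)
      assume "\<not> (\<exists>l<d. i l \<noteq> j l)"
      then have "i = j"
        using I that(1,2) by (intro extensionalityI[of i "{..<d}" j]) auto
      with that(3) show False ..
    qed
    then obtain l where "l < d" "i l \<noteq> j l" by auto
    then show ?thesis using e by (intro prod_zero) (auto simp: orthosys_def)
  qed
  moreover have "(\<Prod>l<d. ip \<mu> (e (i l)) (e (i l))) \<in> {0, 1}" for i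
  proof (cases "\<exists>l<d. ip \<mu> (e (i l)) (e (i l)) = 0")
    case True
    then have "(\<Prod>l<d. ip \<mu> (e (i l)) (e (i l))) = 0" by (intro prod_zero) auto
    then show ?thesis by simp
  next
    case False
    then have "ip \<mu> (e (i l)) (e (i l)) = 1" if "l < d" for l
      using e that by (auto simp: orthosys_def)
    then show ?thesis by simp
  qed
  ultimately show ?thesis
    unfolding orthosys_def ip using tensor_L2[OF \<mu> eL] by simp
qed

text \<open>
  By orthogonality the squared residual is \<open>\<Prod>\<parallel>f l\<parallel>\<^sup>2\<close> minus the sum of the products of squared
  coefficients, the quantity treated in \<open>sparse_tail_le\<close>.
\<close>

lemma residual_tensor:
  assumes \<mu>: "sigma_finite_measure \<mu>" and e: "orthosys \<mu> UNIV e"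
    and fin: "\<And>k. finite {n. lev n \<le> k}" and G: "G \<ge> 1" and \<rho>: "0 < \<rho>" "\<rho> \<le> 1"
    and f: "\<And>l. f l \<in> L2_fun \<mu>" "\<And>l. L2_seminorm \<mu> (f l) \<le> 1"
    and tail: "\<And>l k. (L2_seminorm \<mu> (residual \<mu> {n. lev n \<le> k} e (f l)))\<^sup>2 \<le> G * \<rho> ^ k"
  shows "(L2_seminorm (product_power \<mu> (Suc d))
            (residual (product_power \<mu> (Suc d)) (sparse lev (Suc d) k)
               (\<lambda>i. tensor (Suc d) (\<lambda>l. e (i l))) (tensor (Suc d) f)))\<^sup>2
       \<le> (2 * G / \<rho>) ^ Suc d * (real k + 1) ^ d * \<rho> ^ k"
proof -
  have eL: "e n \<in> L2_fun \<mu>" for n using e by (simp add: orthosys_def)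
  have I: "sparse lev (Suc d) k \<subseteq> extensional {..<Suc d}" unfolding sparse_def by blast
  have os: "orthosys \<mu> {n. lev n \<le> k} e" for k
    by (rule orthosys_subset[OF e]) simp
  have res: "(L2_seminorm \<mu> (residual \<mu> {n. lev n \<le> k} e (f l)))\<^sup>2
      = (L2_seminorm \<mu> (f l))\<^sup>2 - (\<Sum>n | lev n \<le> k. (ip \<mu> (f l) (e n))\<^sup>2)" for k l
    by (rule residual_seminorm[OF os fin f(1)])
  have "(L2_seminorm (product_power \<mu> (Suc d))
            (residual (product_power \<mu> (Suc d)) (sparse lev (Suc d) k)
               (\<lambda>i. tensor (Suc d) (\<lambda>l. e (i l))) (tensor (Suc d) f)))\<^sup>2
      = (\<Prod>l<Suc d. (L2_seminorm \<mu> (f l))\<^sup>2)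
        - (\<Sum>i\<in>sparse lev (Suc d) k. \<Prod>l<Suc d. (ip \<mu> (f l) (e (i l)))\<^sup>2)"
    unfolding residual_seminorm[OF orthosys_tensor[OF \<mu> e I] finite_sparse[OF fin] tensor_L2[OF \<mu> f(1)]]
      L2_seminorm_tensor[OF \<mu> f(1)] ip_tensor[OF \<mu> f(1) eL] prod_power_distrib ..
  also have "\<dots> \<le> (2 * G / \<rho>) ^ Suc d * (real k + 1) ^ d * \<rho> ^ k"
  proof (rule sparse_tail_le[where w = "\<lambda>l n. (ip \<mu> (f l) (e n))\<^sup>2", OF fin G \<rho>])
    show "(\<Sum>n | lev n \<le> k. (ip \<mu> (f l) (e n))\<^sup>2) \<le> (L2_seminorm \<mu> (f l))\<^sup>2" for l k
      by (rule residual_contraction(2)[OF os fin f(1)])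
    show "(L2_seminorm \<mu> (f l))\<^sup>2 - (\<Sum>n | lev n \<le> k. (ip \<mu> (f l) (e n))\<^sup>2) \<le> G * \<rho> ^ k" for l k
      using tail unfolding res .
    show "(L2_seminorm \<mu> (f l))\<^sup>2 \<le> 1" for l
      using f(2) by (intro power_le_one) auto
  qed simp_all
  finally show ?thesis .
qed

section \<open>Covering numbers and entropy\<close>

lemma covering_number_witness:
  assumes "covering_number X dst \<epsilon> T = enat n"
  shows "\<exists>C. finite C \<and> C \<subseteq> X \<and> (\<forall>f\<in>T. \<exists>c\<in>C. dst c f < \<epsilon>) \<and> card C \<le> n"
proof -
  have "covering_number X dst \<epsilon> T < enat (Suc n)" using assms by simp
  then obtain C where C: "finite C" "C \<subseteq> X" "T \<subseteq> (\<Union>c\<in>C. {x \<in> X. dst c x < \<epsilon>})" "card C < Suc n"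
    unfolding covering_number_def INF_less_iff by auto
  have "\<exists>c\<in>C. dst c f < \<epsilon>" if "f \<in> T" for f using C(3) that by blast
  then show ?thesis using C by (intro exI[of _ C]) simp
qed

text \<open>
  The hypothesis speaks of small \<open>\<epsilon>\<close> only. A net at one small radius \<open>\<epsilon>0\<close> also serves the larger
  radii up to \<open>1\<close>, at the price of a larger constant.
\<close>

lemma lesssim_covering_number:
  assumes V: "V > 0"
    and les: "lesssim (\<lambda>\<epsilon>. ereal_of_enat (covering_number X dst \<epsilon> T)) (\<lambda>\<epsilon>. \<epsilon> powr (- V))"
  shows "\<exists>K\<ge>1. \<forall>\<epsilon>. 0 < \<epsilon> \<and> \<epsilon> \<le> 1 \<longrightarrow>
    (\<exists>C. finite C \<and> C \<subseteq> X \<and> (\<forall>f\<in>T. \<exists>c\<in>C. dst c f < \<epsilon>) \<and> real (card C) \<le> K * \<epsilon> powr (- V))"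
proof -
  let ?h = "\<lambda>\<epsilon>. ereal_of_enat (covering_number X dst \<epsilon> T)"
  obtain k :: nat where "Limsup (at_right 0) (\<lambda>\<epsilon>. ?h \<epsilon> / ereal (\<epsilon> powr (- V))) < ereal (real k)"
    using les unfolding lesssim_def using less_PInf_Ex_of_nat by (metis less_irrefl)
  then have "eventually (\<lambda>\<epsilon>. ?h \<epsilon> / ereal (\<epsilon> powr (- V)) < ereal (real k)) (at_right 0)"
    by (rule Limsup_lessD)
  then obtain b where b: "b > 0" "\<And>\<epsilon>. 0 < \<epsilon> \<Longrightarrow> \<epsilon> < b \<Longrightarrow> ?h \<epsilon> / ereal (\<epsilon> powr (- V)) < ereal (real k)"
    unfolding eventually_at_right_field by auto
  have small: "\<exists>C. finite C \<and> C \<subseteq> X \<and> (\<forall>f\<in>T. \<exists>c\<in>C. dst c f < \<epsilon>) \<and> real (card C) \<le> real k * \<epsilon> powr (- V)"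
    if \<epsilon>: "0 < \<epsilon>" "\<epsilon> < b" for \<epsilon>
  proof -
    have pos: "0 < \<epsilon> powr (- V)" using \<epsilon> by simp
    have "?h \<epsilon> \<le> ereal (\<epsilon> powr (- V)) * ereal (real k)"
      using less_imp_le[OF b(2)[OF \<epsilon>]] pos
        ereal_divide_le_pos[of "ereal (\<epsilon> powr (- V))" "?h \<epsilon>" "ereal (real k)"] by simp
    then obtain n where n: "covering_number X dst \<epsilon> T = enat n" "real n \<le> real k * \<epsilon> powr (- V)"
      by (cases "covering_number X dst \<epsilon> T") (auto simp: mult.commute)
    from covering_number_witness[OF n(1)] show ?thesis using n(2) by fastforce
  qed
  define \<epsilon>0 where "\<epsilon>0 = min b 1 / 2"
  have \<epsilon>0: "0 < \<epsilon>0" "\<epsilon>0 < b" "\<epsilon>0 < 1" using b by (auto simp: \<epsilon>0_def)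
  define K where "K = max 1 (real k * \<epsilon>0 powr (- V))"
  have K: "1 \<le> K" "real k * \<epsilon>0 powr (- V) \<le> K" by (auto simp: K_def)
  have "\<exists>C. finite C \<and> C \<subseteq> X \<and> (\<forall>f\<in>T. \<exists>c\<in>C. dst c f < \<epsilon>) \<and> real (card C) \<le> K * \<epsilon> powr (- V)"
    if \<epsilon>: "0 < \<epsilon>" "\<epsilon> \<le> 1" for \<epsilon>
  proof (cases "\<epsilon> < \<epsilon>0")
    case True
    have "1 \<le> \<epsilon>0 powr (- V)" using \<epsilon>0 V by (simp add: powr_minus one_le_inverse_iff powr_le1)
    then have "real k * 1 \<le> real k * \<epsilon>0 powr (- V)" by (intro mult_left_mono) auto
    then have "real k * \<epsilon> powr (- V) \<le> K * \<epsilon> powr (- V)"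
      using K by (intro mult_right_mono) auto
    moreover obtain C where "finite C" "C \<subseteq> X" "\<forall>f\<in>T. \<exists>c\<in>C. dst c f < \<epsilon>"
      "real (card C) \<le> real k * \<epsilon> powr (- V)"
      using small[OF \<epsilon>(1) less_trans[OF True \<epsilon>0(2)]] by (elim exE conjE)
    ultimately show ?thesis by (intro exI[of _ C] conjI) (assumption | linarith)+
  next
    case False
    have "1 \<le> \<epsilon> powr (- V)" using \<epsilon> V by (simp add: powr_minus one_le_inverse_iff powr_le1)
    then have "K * 1 \<le> K * \<epsilon> powr (- V)" using K by (intro mult_left_mono) auto
    moreover obtain C where C: "finite C" "C \<subseteq> X" "\<forall>f\<in>T. \<exists>c\<in>C. dst c f < \<epsilon>0"
      "real (card C) \<le> real k * \<epsilon>0 powr (- V)"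
      using small[OF \<epsilon>0(1,2)] by (elim exE conjE)
    moreover have "\<forall>f\<in>T. \<exists>c\<in>C. dst c f < \<epsilon>"
      using C(3) False by (meson less_le_trans not_less)
    ultimately show ?thesis using K by (intro exI[of _ C] conjI) (assumption | linarith)+
  qed
  then show ?thesis using K(1) by blast
qed

lemma metric_entropy_le:
  assumes C: "finite C" "C \<subseteq> L2_fun M" "T \<subseteq> L2_fun M" "\<And>f. f \<in> T \<Longrightarrow> \<exists>c\<in>C. L2_dist M c f < \<epsilon>"
    and B: "real (card C) \<le> B" "1 \<le> B"
  shows "metric_entropy (L2_fun M) (L2_dist M) \<epsilon> T \<le> ereal (ln B)"
proof -
  have "T \<subseteq> (\<Union>c\<in>C. {x \<in> L2_fun M. L2_dist M c x < \<epsilon>})"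
    using C(3,4) by blast
  then have "covering_number (L2_fun M) (L2_dist M) \<epsilon> T \<le> enat (card C)"
    unfolding covering_number_def using C(1,2) by (intro INF_lower) simp
  then obtain n where n: "covering_number (L2_fun M) (L2_dist M) \<epsilon> T = enat n" "n \<le> card C"
    by (cases "covering_number (L2_fun M) (L2_dist M) \<epsilon> T") auto
  have "ln (real n) \<le> ln B"
  proof (cases "n = 0")
    case False
    have "real n \<le> B" using n(2) B(1) by linarith
    then show ?thesis using False by simp
  qed (use B in simp)
  then show ?thesis by (simp add: metric_entropy_def n(1))
qed

text \<open>
  The factor \<open>2\<close> pays for the passage from an element of the closure to a nearby element of
  \<open>T\<close>.
\<close>

lemma metric_entropy_closure_le:
  assumes cov: "coverable M r T B" and TL: "T \<subseteq> L2_fun M" and B: "1 \<le> B" and r: "0 < r" "2 * r \<le> \<epsilon>"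
  shows "metric_entropy (L2_fun M) (L2_dist M) \<epsilon> (L2_closure M T) \<le> ereal (ln B)"
proof -
  obtain C where C: "finite C" "C \<subseteq> L2_fun M" "\<forall>f\<in>T. \<exists>c\<in>C. L2_dist M c f < r" "real (card C) \<le> B"
    using cov unfolding coverable_def by (elim exE conjE)
  have sub: "L2_closure M T \<subseteq> L2_fun M" by (auto simp: L2_closure_def)
  have "\<exists>c\<in>C. L2_dist M c f < \<epsilon>" if f: "f \<in> L2_closure M T" for f
  proof -
    obtain g where g: "g \<in> T" "L2_dist M f g < r"
      using f r unfolding L2_closure_def by auto
    obtain c where c: "c \<in> C" "L2_dist M c g < r" using C(3) g(1) by blast
    have "f \<in> L2_fun M" "g \<in> L2_fun M" "c \<in> L2_fun M" using f sub g(1) TL c(1) C(2) by auto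
    then have "L2_dist M c f \<le> L2_dist M c g + L2_dist M f g"
      using L2_dist_triangle[of c M g f] L2_dist_commute[of M f g] by simp
    then show ?thesis using c g r by (intro bexI[of _ c]) auto
  qed
  then show ?thesis by (intro metric_entropy_le[OF C(1,2) sub _ C(4) B])
qed

section \<open>Nested approximations and nets of the generators\<close>

text \<open>
  Concatenate bases of \<open>\<V> 0, \<V> 1, \<dots>\<close> and orthogonalise. The block of \<open>\<V> k\<close> occupies the indices
  from \<open>N k = q (2^k - 1)\<close> on, and \<open>lev n\<close> is the number of the block that contains \<open>n\<close>. The first
  \<open>k + 1\<close> blocks span a space that contains \<open>\<V> k\<close> and has at most twice its dimension, so the
  approximation error of \<open>\<V> k\<close> bounds the residual.
\<close>

lemma nested_approximations_orthosys:
  assumes q: "q \<ge> 1" and \<gamma>: "\<gamma> > 0" and W: "W > 0"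
    and \<psi>: "\<And>v. v \<in> {0..1} \<Longrightarrow> \<psi> v \<in> L2_fun \<mu>"
    and \<psi>1: "\<And>v. v \<in> {0..1} \<Longrightarrow> L2_seminorm \<mu> (\<psi> v) \<le> 1"
    and nest: "nested_approximations \<mu> \<psi> q \<gamma> W \<V>"
  defines "\<rho> \<equiv> 2 powr (- 2 / W)"
  shows "\<exists>(e :: nat \<Rightarrow> 'a \<Rightarrow> real) lev. orthosys \<mu> UNIV e \<and>
    (\<forall>k. finite {n. lev n \<le> k} \<and> real (card {n. lev n \<le> k}) \<le> 2 * real q * 2 ^ k) \<and>
    (\<forall>k. \<forall>v\<in>{0..1}. (L2_seminorm \<mu> (residual \<mu> {n. lev n \<le> k} e (\<psi> v)))\<^sup>2 \<le> max 1 (\<gamma>\<^sup>2) * \<rho> ^ k)"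
proof -
  have sub: "\<V> k \<subseteq> L2_fun \<mu>" and dim: "L2_has_dim \<mu> (\<V> k) (q * 2 ^ k)" for k
    using nest by (auto simp: nested_approximations_def L2_subspace_def)
  have "\<forall>k. \<exists>b. (\<forall>i<q * 2 ^ k. b i \<in> \<V> k) \<and>
      (\<forall>f\<in>\<V> k. \<exists>c. AE x in \<mu>. f x = (\<Sum>i<q * 2 ^ k. c i * b i x))"
    using dim unfolding L2_has_dim_def by blast
  then obtain b where bb: "\<forall>k. (\<forall>i<q * 2 ^ k. b k i \<in> \<V> k) \<and>
      (\<forall>f\<in>\<V> k. \<exists>c. AE x in \<mu>. f x = (\<Sum>i<q * 2 ^ k. c i * b k i x))"
    by (rule choice[THEN exE])
  then have b: "\<And>k i. i < q * 2 ^ k \<Longrightarrow> b k i \<in> \<V> k"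
    "\<And>k f. f \<in> \<V> k \<Longrightarrow> \<exists>c. AE x in \<mu>. f x = (\<Sum>i<q * 2 ^ k. c i * b k i x)"
    by simp_all
  define N where "N = (\<lambda>k. q * (2 ^ k - 1) :: nat)"
  have N_Suc: "N (Suc k) = N k + q * 2 ^ k" for k
  proof -
    have "(2 :: nat) ^ Suc k - 1 = (2 ^ k - 1) + 2 ^ k" by simp
    then show ?thesis unfolding N_def by (simp only: distrib_left)
  qed
  have N_mono: "mono N"
    unfolding mono_iff_le_Suc N_Suc by simp
  have N_ex: "\<exists>k. n < N (Suc k)" for n
  proof
    have "n < 2 ^ n" by simp
    also have "\<dots> \<le> q * 2 ^ n" using q by simp
    finally show "n < N (Suc n)" unfolding N_Suc by simp
  qed
  define lev where "lev = (\<lambda>n. LEAST k. n < N (Suc k))"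
  have lev_less: "n < N (Suc (lev n))" for n
    unfolding lev_def by (rule LeastI_ex[OF N_ex])
  have lev_le_iff: "lev n \<le> k \<longleftrightarrow> n < N (Suc k)" for n k
  proof
    assume "lev n \<le> k"
    then have "N (Suc (lev n)) \<le> N (Suc k)" using N_mono by (simp add: mono_def)
    then show "n < N (Suc k)" using lev_less[of n] by linarith
  qed (simp add: lev_def Least_le)
  have lev_set: "{n. lev n \<le> k} = {..<N (Suc k)}" for k
    using lev_le_iff by auto
  define F where "F = (\<lambda>n. b (lev n) (n - N (lev n)))"
  have F_idx: "n - N (lev n) < q * 2 ^ lev n" for n
  proof -
    have "0 < q * 2 ^ lev n" using q by simp
    then show ?thesis using lev_less[of n] unfolding N_Suc by linarith
  qed
  have FL: "F n \<in> L2_fun \<mu>" for n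
    unfolding F_def using b(1)[OF F_idx] sub by blast
  have F_block: "F (N k + i) = b k i" if i: "i < q * 2 ^ k" for k i
  proof -
    have "lev (N k + i) \<le> k" using i by (simp add: lev_le_iff N_Suc)
    moreover have "k \<le> lev (N k + i)"
    proof (rule ccontr)
      assume "\<not> k \<le> lev (N k + i)"
      then have "Suc (lev (N k + i)) \<le> k" by simp
      then have "N (Suc (lev (N k + i))) \<le> N k" using N_mono by (simp add: mono_def)
      then show False using lev_less[of "N k + i"] by linarith
    qed
    ultimately have "lev (N k + i) = k" by simp
    then show ?thesis by (simp add: F_def)
  qed
  define e where "e = gram_schmidt \<mu> F"
  have os: "orthosys \<mu> UNIV e" unfolding e_def by (rule gram_schmidt_orthosys[OF FL])
  have best: "L2_seminorm \<mu> (residual \<mu> {n. lev n \<le> k} e (\<psi> v)) \<le> L2_dist \<mu> (\<psi> v) f"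
    if v: "v \<in> {0..1}" and f: "f \<in> \<V> k" for v f k
  proof -
    obtain c where c: "AE x in \<mu>. f x = (\<Sum>i<q * 2 ^ k. c i * b k i x)" using b(2)[OF f] by auto
    let ?B = "(\<lambda>i. N k + i) ` {..<q * 2 ^ k}"
    have "(\<Sum>n\<in>?B. c (n - N k) * F n x) = (\<Sum>i<q * 2 ^ k. c i * b k i x)" for x
      by (subst sum.reindex) (auto simp: F_block intro!: sum.cong)
    then have "AE x in \<mu>. f x = (\<Sum>n\<in>?B. c (n - N k) * F n x)" using c by simp
    moreover have "?B \<subseteq> {..<N (Suc k)}" by (auto simp: N_Suc)
    ultimately show ?thesis
      unfolding e_def lev_set
      using gram_schmidt_best_approximation[of F \<mu> "\<psi> v" ?B "N (Suc k)" f "\<lambda>n. c (n - N k)"] FL \<psi>[OF v] f sub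
      by blast
  qed
  have osk: "orthosys \<mu> {n. lev n \<le> k} e" for k by (rule orthosys_subset[OF os]) simp
  have fin: "finite {n. lev n \<le> k}" for k by (simp add: lev_set)
  have card: "real (card {n. lev n \<le> k}) \<le> 2 * real q * 2 ^ k" for k
  proof -
    have "N (Suc k) \<le> q * 2 ^ Suc k" by (simp add: N_def)
    then have "real (N (Suc k)) \<le> real (q * 2 ^ Suc k)" by (rule of_nat_mono)
    then show ?thesis by (simp add: lev_set mult_ac)
  qed
  have tail: "(L2_seminorm \<mu> (residual \<mu> {n. lev n \<le> k} e (\<psi> v)))\<^sup>2 \<le> max 1 (\<gamma>\<^sup>2) * \<rho> ^ k"
    if v: "v \<in> {0..1}" for k v
  proof (cases "k = 0")
    case True
    have "L2_seminorm \<mu> (residual \<mu> {n. lev n \<le> k} e (\<psi> v)) \<le> 1"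
      using residual_contraction(1)[OF osk fin \<psi>[OF v], of k] \<psi>1[OF v] by linarith
    then have "(L2_seminorm \<mu> (residual \<mu> {n. lev n \<le> k} e (\<psi> v)))\<^sup>2 \<le> 1"
      by (intro power_le_one) auto
    then show ?thesis using True by simp
  next
    case False
    have \<rho>k: "2 powr (- 2 * real k / W) = \<rho> ^ k"
      unfolding \<rho>_def by (simp add: powr_power mult.commute)
    have "(INF f\<in>\<V> k. \<integral>\<^sup>+x. ennreal ((\<psi> v x - f x)\<^sup>2) \<partial>\<mu>)
        \<le> (SUP v\<in>{0..1}. INF f\<in>\<V> k. \<integral>\<^sup>+x. ennreal ((\<psi> v x - f x)\<^sup>2) \<partial>\<mu>)"
      using v by (rule SUP_upper)
    also have "\<dots> \<le> ennreal (\<gamma>\<^sup>2 * 2 powr (- 2 * real k / W))"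
      using nest False unfolding nested_approximations_def by simp
    finally have INF: "(INF f\<in>\<V> k. \<integral>\<^sup>+x. ennreal ((\<psi> v x - f x)\<^sup>2) \<partial>\<mu>) \<le> ennreal (\<gamma>\<^sup>2 * \<rho> ^ k)"
      unfolding \<rho>k .
    have \<rho>0: "0 \<le> \<rho>" by (simp add: \<rho>_def)
    have "(L2_seminorm \<mu> (residual \<mu> {n. lev n \<le> k} e (\<psi> v)))\<^sup>2 \<le> \<gamma>\<^sup>2 * \<rho> ^ k"
    proof (rule field_le_epsilon)
      fix \<delta> :: real assume \<delta>: "0 < \<delta>"
      have "ennreal (\<gamma>\<^sup>2 * \<rho> ^ k) < ennreal (\<gamma>\<^sup>2 * \<rho> ^ k + \<delta>)"
        using \<delta> \<rho>0 by (intro ennreal_lessI) (auto intro!: add_nonneg_pos)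
      with INF have "(INF f\<in>\<V> k. \<integral>\<^sup>+x. ennreal ((\<psi> v x - f x)\<^sup>2) \<partial>\<mu>) < ennreal (\<gamma>\<^sup>2 * \<rho> ^ k + \<delta>)"
        by (rule le_less_trans)
      then obtain f where f: "f \<in> \<V> k"
        "(\<integral>\<^sup>+x. ennreal ((\<psi> v x - f x)\<^sup>2) \<partial>\<mu>) < ennreal (\<gamma>\<^sup>2 * \<rho> ^ k + \<delta>)"
        unfolding INF_less_iff by blast
      have "(\<lambda>x. \<psi> v x - f x) \<in> L2_fun \<mu>"
        using \<psi>[OF v] f(1) sub by (intro L2_fun_diff) auto
      then have "(\<integral>\<^sup>+x. ennreal ((\<psi> v x - f x)\<^sup>2) \<partial>\<mu>) = ennreal (\<integral>x. (\<psi> v x - f x)\<^sup>2 \<partial>\<mu>)"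
        by (intro nn_integral_eq_integral) (auto simp: L2_fun_def)
      with f(2) have "(\<integral>x. (\<psi> v x - f x)\<^sup>2 \<partial>\<mu>) < \<gamma>\<^sup>2 * \<rho> ^ k + \<delta>"
        by (simp add: ennreal_less_iff)
      then have "(L2_dist \<mu> (\<psi> v) f)\<^sup>2 \<le> \<gamma>\<^sup>2 * \<rho> ^ k + \<delta>"
        by (simp add: L2_dist_def L2_seminorm_def)
      moreover have "(L2_seminorm \<mu> (residual \<mu> {n. lev n \<le> k} e (\<psi> v)))\<^sup>2 \<le> (L2_dist \<mu> (\<psi> v) f)\<^sup>2"
        using best[OF v f(1)] by (intro power_mono) auto
      ultimately show "(L2_seminorm \<mu> (residual \<mu> {n. lev n \<le> k} e (\<psi> v)))\<^sup>2 \<le> \<gamma>\<^sup>2 * \<rho> ^ k + \<delta>"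
        by linarith
    qed
    also have "\<dots> \<le> max 1 (\<gamma>\<^sup>2) * \<rho> ^ k"
      using \<rho>0 by (intro mult_right_mono) auto
    finally show ?thesis .
  qed
  show ?thesis by (intro exI[of _ e] exI[of _ lev] conjI allI ballI os fin card tail)
qed

lemma absconv_tensor_combs_subset:
  "absconv_tensor_combs d \<psi> \<subseteq> abs_hull (PiE {..<d} (\<lambda>_. {0..1})) (\<lambda>v. tensor d (\<lambda>l. \<psi> (v l)))"
proof
  fix f assume "f \<in> absconv_tensor_combs d \<psi>"
  then obtain A \<beta> where f: "f = (\<lambda>u. \<Sum>v\<in>PiE {..<d} A. \<beta> v * (\<Prod>i<d. \<psi> (v i) (u i)))"
    and A: "\<And>i. i < d \<Longrightarrow> finite (A i)" "\<And>i. i < d \<Longrightarrow> A i \<subseteq> {0..1}"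
    and \<beta>: "(\<Sum>v\<in>PiE {..<d} A. \<bar>\<beta> v\<bar>) \<le> 1"
    unfolding absconv_tensor_combs_def by auto
  have "finite (PiE {..<d} A)" using A(1) by (intro finite_PiE) auto
  moreover have "PiE {..<d} A \<subseteq> PiE {..<d} (\<lambda>_. {0..1})" using A(2) by (intro PiE_mono) auto
  ultimately show "f \<in> abs_hull (PiE {..<d} (\<lambda>_. {0..1})) (\<lambda>v. tensor d (\<lambda>l. \<psi> (v l)))"
    unfolding abs_hull_def f tensor_def using \<beta>
    by (intro CollectI exI[of _ "PiE {..<d} A"] exI[of _ \<beta>] conjI refl)
qed

text \<open>
  A net of \<open>\<Psi>\<close> of radius \<open>\<delta>\<close> is moved into \<open>\<Psi>\<close>, which doubles the radius, and its \<open>d\<close>-fold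
  products form a net of radius \<open>2 d \<delta>\<close> by \<open>tensor_lipschitz\<close>. With \<open>\<delta>\<close> proportional to \<open>2^(-n)\<close>
  the logarithm of its size grows linearly in \<open>n\<close>, whatever the exponent \<open>V\<close>.
\<close>

lemma tensor_net:
  assumes \<mu>: "sigma_finite_measure \<mu>" and d: "d \<ge> 1" and V: "V > 0"
    and \<psi>: "\<And>v. v \<in> {0..1} \<Longrightarrow> \<psi> v \<in> L2_fun \<mu>"
    and \<psi>1: "\<And>v. v \<in> {0..1} \<Longrightarrow> L2_seminorm \<mu> (\<psi> v) \<le> 1"
    and les: "lesssim (\<lambda>\<epsilon>. ereal_of_enat (covering_number (L2_fun \<mu>) (L2_dist \<mu>) \<epsilon> (\<psi> ` {0..1})))
           (\<lambda>\<epsilon>. \<epsilon> powr (- V))"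
  defines "J \<equiv> PiE {..<d} (\<lambda>_. {0..1 :: real})" and "g \<equiv> \<lambda>v. tensor d (\<lambda>l. \<psi> (v l))"
  shows "\<exists>C>0. \<forall>n. \<exists>J0. finite J0 \<and> J0 \<subseteq> J \<and>
    (\<forall>a\<in>J. \<exists>b\<in>J0. L2_dist (product_power \<mu> d) (g a) (g b) \<le> (2 / 2 ^ n) / 16) \<and>
    ln (2 * real (card J0) + 1) \<le> C * (real n + 1)"
proof -
  obtain K where K: "K \<ge> 1" "\<forall>\<epsilon>. 0 < \<epsilon> \<and> \<epsilon> \<le> 1 \<longrightarrow>
    (\<exists>C. finite C \<and> C \<subseteq> L2_fun \<mu> \<and> (\<forall>f\<in>\<psi> ` {0..1}. \<exists>c\<in>C. L2_dist \<mu> c f < \<epsilon>) \<and> real (card C) \<le> K * \<epsilon> powr (- V))"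
    using lesssim_covering_number[OF V les] by (elim exE conjE)
  define C where "C = ln 3 + real d * (ln K + V * ln (16 * real d)) + real d * (V * ln 2)"
  have c0: "0 \<le> ln K" "0 \<le> ln (16 * real d)" using K d by auto
  have "C > 0" unfolding C_def using V c0 by (intro add_pos_nonneg) (auto intro!: mult_nonneg_nonneg add_nonneg_nonneg)
  moreover have "\<exists>J0. finite J0 \<and> J0 \<subseteq> J \<and>
    (\<forall>a\<in>J. \<exists>b\<in>J0. L2_dist (product_power \<mu> d) (g a) (g b) \<le> (2 / 2 ^ n) / 16) \<and>
    ln (2 * real (card J0) + 1) \<le> C * (real n + 1)" for n
  proof -
    define \<delta> where "\<delta> = 1 / (16 * real d * 2 ^ n)"
    have dpos: "real d > 0" using d by simp
    have \<delta>: "0 < \<delta>" using dpos by (simp add: \<delta>_def)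
    have "1 * 1 \<le> (16 * real d) * 2 ^ n" using d by (intro mult_mono) auto
    then have \<delta>1: "\<delta> \<le> 1" using dpos by (simp add: \<delta>_def divide_le_eq)
    obtain F where F: "finite F" "F \<subseteq> L2_fun \<mu>" "\<forall>f\<in>\<psi> ` {0..1}. \<exists>c\<in>F. L2_dist \<mu> c f < \<delta>"
      "real (card F) \<le> K * \<delta> powr (- V)"
      using K(2)[THEN spec, THEN mp, OF conjI[OF \<delta> \<delta>1]] by (elim exE conjE)
    \<comment> \<open>The net may have centres outside \<open>\<Psi>\<close>; choose a member of \<open>\<Psi>\<close> near each centre that has one.\<close>
    define pick where "pick = (\<lambda>c. SOME w. w \<in> {0..1} \<and> L2_dist \<mu> c (\<psi> w) < \<delta>)"
    define F' where "F' = {c \<in> F. \<exists>w\<in>{0..1}. L2_dist \<mu> c (\<psi> w) < \<delta>}"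
    define Vn where "Vn = pick ` F'"
    have pick: "pick c \<in> {0..1} \<and> L2_dist \<mu> c (\<psi> (pick c)) < \<delta>" if "c \<in> F'" for c
      unfolding pick_def by (rule someI_ex) (use that in \<open>auto simp: F'_def\<close>)
    have finV: "finite Vn" using F(1) by (simp add: Vn_def F'_def)
    have cardV: "card Vn \<le> card F"
    proof -
      have "card Vn \<le> card F'" unfolding Vn_def using F(1) by (intro card_image_le) (simp add: F'_def)
      also have "\<dots> \<le> card F" using F(1) by (intro card_mono) (auto simp: F'_def)
      finally show ?thesis .
    qed
    have subV: "Vn \<subseteq> {0..1}" unfolding Vn_def using pick by auto
    have nearV: "\<exists>w. w \<in> Vn \<and> L2_dist \<mu> (\<psi> v) (\<psi> w) \<le> 2 * \<delta>" if v: "v \<in> {0..1}" for v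
    proof -
      obtain c where c: "c \<in> F" "L2_dist \<mu> c (\<psi> v) < \<delta>" using F(3) v by blast
      then have cF: "c \<in> F'" using v by (auto simp: F'_def)
      have cL: "c \<in> L2_fun \<mu>" using c F by auto
      have "L2_dist \<mu> (\<psi> v) (\<psi> (pick c)) \<le> L2_dist \<mu> (\<psi> v) c + L2_dist \<mu> c (\<psi> (pick c))"
        using pick[OF cF] by (intro L2_dist_triangle \<psi> v cL) auto
      then have "L2_dist \<mu> (\<psi> v) (\<psi> (pick c)) \<le> 2 * \<delta>"
        using pick[OF cF] c(2) L2_dist_commute[of \<mu> "\<psi> v" c] by simp
      moreover have "pick c \<in> Vn" using cF by (simp add: Vn_def)
      ultimately show ?thesis by blast
    qed
    define J0 where "J0 = PiE {..<d} (\<lambda>_. Vn)"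
    have finJ: "finite J0" unfolding J0_def using finV by (intro finite_PiE) auto
    have subJ: "J0 \<subseteq> J" unfolding J0_def J_def using subV by (intro PiE_mono) auto
    have nearJ: "\<exists>b\<in>J0. L2_dist (product_power \<mu> d) (g a) (g b) \<le> (2 / 2 ^ n) / 16" if a: "a \<in> J" for a
    proof -
      have al: "a l \<in> {0..1}" if "l < d" for l
        using a that unfolding J_def by (auto dest!: PiE_mem)
      have "\<forall>l\<in>{..<d}. \<exists>w. w \<in> Vn \<and> L2_dist \<mu> (\<psi> (a l)) (\<psi> w) \<le> 2 * \<delta>"
        using nearV[OF al] by simp
      then obtain w where w: "\<forall>l\<in>{..<d}. w l \<in> Vn \<and> L2_dist \<mu> (\<psi> (a l)) (\<psi> (w l)) \<le> 2 * \<delta>"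
        by (rule bchoice[THEN exE])
      define b where "b = restrict w {..<d}"
      have b: "b \<in> J0" unfolding b_def J0_def using w by (intro restrict_PiE_iff[THEN iffD2]) simp
      have bl: "b l \<in> {0..1}" if "l < d" for l
        using b subJ that unfolding J_def by (auto dest!: PiE_mem)
      have "L2_dist (product_power \<mu> d) (g a) (g b) \<le> (\<Sum>l<d. L2_dist \<mu> (\<psi> (a l)) (\<psi> (b l)))"
        unfolding g_def 
        by (intro tensor_lipschitz[OF \<mu>] \<psi> \<psi>1 al bl)
      also have "\<dots> \<le> (\<Sum>l<d. 2 * \<delta>)"
        using w by (intro sum_mono) (simp add: b_def)
      also have "\<dots> = (2 / 2 ^ n) / 16" using dpos by (simp add: \<delta>_def field_simps)
      finally show ?thesis using b by blast
    qed
    have cardJ: "ln (2 * real (card J0) + 1) \<le> C * (real n + 1)"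
    proof -
      define Q where "Q = K * \<delta> powr (- V)"
      have "1 \<le> \<delta> powr (- V)" using \<delta> \<delta>1 V by (simp add: powr_minus one_le_inverse_iff powr_le1)
      then have "1 * 1 \<le> Q" unfolding Q_def using K by (intro mult_mono) auto
      then have Q: "1 \<le> Q" by simp
      have Q1: "1 \<le> Q ^ d" using Q by simp
      have "card J0 = card Vn ^ d" unfolding J0_def by (subst card_PiE) auto
      moreover have "real (card Vn) ^ d \<le> Q ^ d"
        using cardV F(4) unfolding Q_def by (intro power_mono) auto
      ultimately have "2 * real (card J0) + 1 \<le> 3 * Q ^ d" using Q1 by simp
      then have "ln (2 * real (card J0) + 1) \<le> ln (3 * Q ^ d)"
        by (intro ln_mono) (auto intro: add_nonneg_pos)
      also have "\<dots> = ln 3 + real d * ln Q" using Q by (simp add: ln_mult ln_realpow)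
      also have "ln Q = ln K + V * (ln (16 * real d) + real n * ln 2)"
      proof -
        have "ln Q = ln K + ln (\<delta> powr (- V))"
          unfolding Q_def using K \<delta> by (intro ln_mult_pos) auto
        also have "ln (\<delta> powr (- V)) = V * (- ln \<delta>)" using \<delta> by (simp add: ln_powr)
        also have "- ln \<delta> = ln (16 * real d * 2 ^ n)" using dpos by (simp add: \<delta>_def ln_div)
        also have "\<dots> = ln (16 * real d) + real n * ln 2"
          using dpos by (simp add: ln_mult_pos ln_realpow)
        finally show ?thesis .
      qed
      also have "ln 3 + real d * (ln K + V * (ln (16 * real d) + real n * ln 2))
          = (ln 3 + real d * (ln K + V * ln (16 * real d))) * 1 + real d * (V * ln 2) * real n"
        by (simp add: algebra_simps)
      also have "\<dots> \<le> (ln 3 + real d * (ln K + V * ln (16 * real d))) * (real n + 1)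
          + real d * (V * ln 2) * (real n + 1)"
        using c0 V by (intro add_mono mult_left_mono) (auto intro!: mult_nonneg_nonneg add_nonneg_nonneg)
      also have "\<dots> = C * (real n + 1)" by (simp add: C_def algebra_simps)
      finally show ?thesis .
    qed
    show ?thesis by (intro exI[of _ J0] conjI ballI finJ subJ nearJ cardJ)
  qed
  ultimately show ?thesis by blast
qed

section \<open>Balancing the two costs and summing over the scales\<close>

lemma log2_Suc_le: "log 2 (real n + 1) \<le> real n"
proof -
  have "real n + 1 \<le> 2 ^ n"
  proof (induction n)
    case (Suc n)
    have "1 \<le> (2 :: real) ^ n" by simp
    then show ?case using Suc by simp
  qed simp
  then have "log 2 (real n + 1) \<le> log 2 (2 ^ n)" by (intro log_mono) auto
  then show ?thesis by (simp add: log_nat_power)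
qed

lemma linear_le_powr:
  assumes a: "a > 0"
  shows "\<exists>C\<ge>0. \<forall>n::nat. real n + 1 \<le> C * 2 powr (a * real n)"
proof -
  define C where "C = 1 + 1 / (a * ln 2)"
  have aln: "0 < a * ln 2" using a by simp
  have "real n + 1 \<le> C * 2 powr (a * real n)" for n
  proof -
    let ?E = "2 powr (a * real n)"
    have "1 + a * real n * ln 2 \<le> exp (a * real n * ln 2)" by (rule exp_ge_add_one_self)
    then have E: "1 + real n * (a * ln 2) \<le> ?E" by (simp add: powr_def mult_ac)
    have "real n * (a * ln 2) \<le> ?E" using E by linarith
    then have "real n \<le> ?E / (a * ln 2)" using aln by (simp only: pos_le_divide_eq)
    moreover have "0 \<le> real n * (a * ln 2)" using a by simp
    then have "1 \<le> ?E" using E by linarith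
    ultimately show ?thesis by (simp add: C_def distrib_right)
  qed
  moreover have "0 \<le> C" using aln by (simp add: C_def less_imp_le)
  ultimately show ?thesis by blast
qed

text \<open>
  The choice of the sparse grid level \<open>k\<close> at scale \<open>n\<close>. The first summand is the cost of the
  projection, the second that of the Maurey average. With \<open>L = n + 1\<close> take \<open>2^k\<close> between \<open>X\<close> and
  \<open>2 X\<close> for \<open>X = L powr (a / 2) * 2 powr (a * n)\<close>. The exponent \<open>a\<close> satisfies
  \<open>a (1 + 2 / W) = 2\<close>, so \<open>X powr (1 + 2 / W) = 4^n L\<close>, and hence
  \<open>4^n L \<rho>^k\<close> is at most \<open>X\<close> like \<open>2^k\<close> up to constants. The polynomial factor in \<open>k\<close> becomes one
  in \<open>L\<close>, since \<open>k = O(L)\<close>.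
\<close>

lemma balance_levels:
  fixes W A S C :: real
  assumes W: "W > 0" and A: "A \<ge> 0" and S: "S \<ge> 0" and C: "C \<ge> 0"
  defines "a \<equiv> 2 * W / (2 + W)" and "\<rho> \<equiv> 2 powr (- 2 / W)"
  shows "\<exists>K\<ge>0. \<forall>n. \<exists>k.
      18 * (A * (real k + 1) ^ d * 2 ^ k + 1) * ln 2
        + (16 * 4 ^ n * (S * (real k + 1) ^ d * \<rho> ^ k) + 2) * (C * (real n + 1))
      \<le> K * ((real n + 1) ^ d * ((real n + 1) powr (a / 2) * 2 powr (a * real n)))"
proof -
  have a: "0 < a" "a \<le> 2" using W by (auto simp: a_def field_simps)
  obtain E where E: "E \<ge> 0" "\<And>n::nat. real n + 1 \<le> E * 2 powr (a * real n)"
    using linear_le_powr[OF a(1)] by blast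
  define K where "K = 36 * A * 3 ^ d + 18 + 16 * S * C * 3 ^ d + 2 * C * E"
  have "0 \<le> K" using A S C E by (simp add: K_def)
  moreover have "\<exists>k.
      18 * (A * (real k + 1) ^ d * 2 ^ k + 1) * ln 2
        + (16 * 4 ^ n * (S * (real k + 1) ^ d * \<rho> ^ k) + 2) * (C * (real n + 1))
      \<le> K * ((real n + 1) ^ d * ((real n + 1) powr (a / 2) * 2 powr (a * real n)))" for n
  proof -
    define L where "L = real n + 1"
    define X where "X = L powr (a / 2) * 2 powr (a * real n)"
    have L: "1 \<le> L" by (simp add: L_def)
    have p1: "1 \<le> L powr (a / 2)" "1 \<le> 2 powr (a * real n)"
      using L a by (auto intro!: ge_one_powr_ge_zero)
    have X: "1 \<le> X" unfolding X_def using mult_mono[OF p1] by simp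
    have pX: "2 powr (a * real n) \<le> X"
      unfolding X_def using mult_right_mono[OF p1(1), of "2 powr (a * real n)"] by simp
    define k where "k = nat \<lceil>log 2 X\<rceil>"
    have logX: "0 \<le> log 2 X" using X by simp
    have k: "log 2 X \<le> real k" "real k \<le> log 2 X + 1"
      using logX unfolding k_def by linarith+
    have k_lower: "X \<le> 2 ^ k"
    proof -
      have "2 powr (log 2 X) \<le> 2 powr (real k)" using k by simp
      then show ?thesis using X by (simp add: powr_realpow)
    qed
    have k_upper: "2 ^ k \<le> 2 * X"
    proof -
      have "2 powr (real k) \<le> 2 powr (log 2 X + 1)" using k by simp
      then show ?thesis using X by (simp add: powr_realpow powr_add)
    qed
    have k_lin: "real k + 1 \<le> 3 * L"
    proof -
      have "log 2 X = a / 2 * log 2 L + a * real n"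
        unfolding X_def using L by (simp add: log_mult log_powr)
      also have "\<dots> \<le> 1 * real n + 2 * real n"
        using a log2_Suc_le[of n] L unfolding L_def by (intro add_mono mult_mono) auto
      finally have "log 2 X \<le> 3 * real n" by simp
      then show ?thesis using k(2) by (simp add: L_def)
    qed
    have kd: "(real k + 1) ^ d \<le> 3 ^ d * L ^ d"
      unfolding power_mult_distrib[symmetric] using k_lin by (intro power_mono) auto
    have Ld: "1 \<le> L ^ d" using L by simp
    have \<rho>k: "\<rho> ^ k \<le> X powr (- 2 / W)"
    proof -
      have "\<rho> ^ k = (2 ^ k) powr (- 2 / W)"
        unfolding \<rho>_def by (simp add: powr_realpow[symmetric] powr_powr mult.commute)
      also have "\<dots> \<le> X powr (- 2 / W)"
        using k_lower X W by (intro powr_mono2') auto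
      finally show ?thesis .
    qed
    have balance: "4 ^ n * L * X powr (- 2 / W) = X"
    proof -
      have ee: "a / 2 * (1 + 2 / W) = 1" "a * real n * (1 + 2 / W) = 2 * real n"
      proof -
        have "1 + 2 / W = (2 + W) / W" using W by (simp add: field_simps)
        then have e: "a * (1 + 2 / W) = 2"
          unfolding a_def using W by (simp add: add_nonneg_eq_0_iff)
        have "a / 2 * (1 + 2 / W) = a * (1 + 2 / W) / 2" by simp
        then show "a / 2 * (1 + 2 / W) = 1" unfolding e by simp
        have "a * real n * (1 + 2 / W) = a * (1 + 2 / W) * real n" by (simp only: mult_ac)
        then show "a * real n * (1 + 2 / W) = 2 * real n" unfolding e .
      qed
      have "X powr (1 + 2 / W) = L powr (a / 2 * (1 + 2 / W)) * 2 powr (a * real n * (1 + 2 / W))"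
        unfolding X_def using L by (simp add: powr_mult powr_powr)
      also have "\<dots> = L * 4 ^ n"
      proof -
        have "2 powr (2 * real n) = (2 powr 2) powr real n" by (simp only: powr_powr)
        also have "\<dots> = 4 ^ n" by (simp add: powr_realpow)
        finally show ?thesis unfolding ee using L by simp
      qed
      finally have "4 ^ n * L * X powr (- 2 / W) = X powr (1 + 2 / W) * X powr (- 2 / W)" by simp
      also have "\<dots> = X" using X by (simp add: powr_add[symmetric])
      finally show ?thesis .
    qed
    have t1: "18 * (A * (real k + 1) ^ d * 2 ^ k + 1) * ln 2 \<le> (36 * A * 3 ^ d + 18) * (L ^ d * X)"
    proof -
      have "A * (real k + 1) ^ d * 2 ^ k \<le> A * (3 ^ d * L ^ d) * (2 * X)"
        using A kd k_upper X L by (intro mult_mono) auto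
      moreover have "1 * 1 \<le> L ^ d * X" using Ld X by (intro mult_mono) auto
      ultimately have "18 * (A * (real k + 1) ^ d * 2 ^ k + 1) \<le> (36 * A * 3 ^ d + 18) * (L ^ d * X)"
        by (simp add: algebra_simps)
      moreover have "0 \<le> 18 * (A * (real k + 1) ^ d * 2 ^ k + 1)" using A by simp
      moreover have "ln 2 \<le> (1 :: real)" using ln_le_minus_one[of 2] by simp
      ultimately show ?thesis
        by (meson mult_left_le order_trans)
    qed
    have t2: "16 * 4 ^ n * (S * (real k + 1) ^ d * \<rho> ^ k) * (C * L) \<le> 16 * S * C * 3 ^ d * (L ^ d * X)"
    proof -
      have "(real k + 1) ^ d * \<rho> ^ k \<le> (3 ^ d * L ^ d) * X powr (- 2 / W)"
        using kd \<rho>k L by (intro mult_mono) (auto simp: \<rho>_def)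
      then have "16 * S * C * (4 ^ n * L) * ((real k + 1) ^ d * \<rho> ^ k)
          \<le> 16 * S * C * (4 ^ n * L) * ((3 ^ d * L ^ d) * X powr (- 2 / W))"
        using S C L by (intro mult_left_mono) auto
      also have "\<dots> = 16 * S * C * 3 ^ d * (L ^ d * (4 ^ n * L * X powr (- 2 / W)))" by (simp add: mult_ac)
      finally show ?thesis unfolding balance by (simp add: mult_ac)
    qed
    have t3: "2 * (C * L) \<le> 2 * C * E * (L ^ d * X)"
    proof -
      have "L \<le> E * X" using E(2)[of n] mult_left_mono[OF pX E(1)] unfolding L_def by linarith
      also have "\<dots> \<le> E * (L ^ d * X)"
        using E(1) X mult_right_mono[OF Ld, of X] by (intro mult_left_mono) auto
      finally have "2 * C * L \<le> 2 * C * (E * (L ^ d * X))" using C by (intro mult_left_mono) auto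
      then show ?thesis by (simp add: mult_ac)
    qed
    have "18 * (A * (real k + 1) ^ d * 2 ^ k + 1) * ln 2
        + (16 * 4 ^ n * (S * (real k + 1) ^ d * \<rho> ^ k) + 2) * (C * L) \<le> K * (L ^ d * X)"
      using t1 t2 t3 unfolding K_def by (simp add: distrib_right)
    then show ?thesis unfolding L_def X_def by blast
  qed
  ultimately show ?thesis by blast
qed

text \<open>
  The polynomial factors are largest at \<open>n\<close>, and a geometric series with ratio \<open>2 powr a > 1\<close>
  remains.
\<close>

lemma sum_entropy_increments:
  fixes a :: real and d n :: nat
  assumes a: "a > 0"
  defines "h \<equiv> \<lambda>n. (real n + 1) ^ d * ((real n + 1) powr (a / 2) * 2 powr (a * real n))"
  shows "(\<Sum>i<n. h i) \<le> h n / (2 powr a - 1)"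
proof -
  have b: "1 < 2 powr a" using a by simp
  have "(\<Sum>i<n. h i) \<le> (\<Sum>i<n. ((real n + 1) ^ d * (real n + 1) powr (a / 2)) * (2 powr a) ^ i)"
  proof (rule sum_mono)
    fix i assume "i \<in> {..<n}"
    then have i: "real i + 1 \<le> real n + 1" by simp
    have "h i = ((real i + 1) ^ d * (real i + 1) powr (a / 2)) * (2 powr a) ^ i"
      by (simp add: h_def powr_power mult_ac)
    also have "\<dots> \<le> ((real n + 1) ^ d * (real n + 1) powr (a / 2)) * (2 powr a) ^ i"
      using i a by (intro mult_right_mono mult_mono power_mono powr_mono2) auto
    finally show "h i \<le> ((real n + 1) ^ d * (real n + 1) powr (a / 2)) * (2 powr a) ^ i" .
  qed
  also have "\<dots> = ((real n + 1) ^ d * (real n + 1) powr (a / 2)) * (((2 powr a) ^ n - 1) / (2 powr a - 1))"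
    unfolding sum_distrib_left[symmetric] using b by (subst geometric_sum) auto
  also have "\<dots> \<le> ((real n + 1) ^ d * (real n + 1) powr (a / 2)) * ((2 powr a) ^ n / (2 powr a - 1))"
    using b by (intro mult_left_mono divide_right_mono) auto
  also have "\<dots> = h n / (2 powr a - 1)"
    by (simp add: h_def powr_power mult_ac)
  finally show ?thesis .
qed

text \<open>
  Passing from dyadic radii to all small \<open>\<epsilon>\<close>: for \<open>n\<close> with \<open>2^n\<close> between \<open>4 / \<epsilon>\<close> and \<open>8 / \<epsilon>\<close>,
  both \<open>n + 1\<close> and \<open>2^n\<close> are bounded by multiples of \<open>ln (1 / \<epsilon>)\<close> and \<open>1 / \<epsilon>\<close>. The spare
  factor \<open>2\<close> in \<open>2 * (2 / 2^n) \<le> \<epsilon>\<close> is the one that the closure needs.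
\<close>

lemma dyadic_scale:
  fixes a :: real
  assumes a: "a > 0"
  shows "\<exists>C>0. \<forall>\<epsilon>. 0 < \<epsilon> \<and> \<epsilon> \<le> 1 / 2 \<longrightarrow> (\<exists>n. 2 * (2 / 2 ^ n) \<le> \<epsilon> \<and>
     (real n + 1) ^ d * ((real n + 1) powr (a / 2) * 2 powr (a * real n))
       \<le> C * (\<epsilon> powr (- a) * ln (1 / \<epsilon>) ^ d * ln (1 / \<epsilon>) powr (a / 2)))"
proof -
  define c where "c = 5 / ln (2 :: real)"
  have c: "0 < c" by (simp add: c_def)
  define C where "C = c ^ d * (c powr (a / 2) * 8 powr a)"
  have "0 < C" using c by (simp add: C_def)
  moreover have "\<exists>n. 2 * (2 / 2 ^ n) \<le> \<epsilon> \<and>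
     (real n + 1) ^ d * ((real n + 1) powr (a / 2) * 2 powr (a * real n))
       \<le> C * (\<epsilon> powr (- a) * ln (1 / \<epsilon>) ^ d * ln (1 / \<epsilon>) powr (a / 2))"
    if \<epsilon>: "0 < \<epsilon>" "\<epsilon> \<le> 1 / 2" for \<epsilon>
  proof -
    define l where "l = log 2 (1 / \<epsilon>)"
    have l: "1 \<le> l"
    proof -
      have "2 \<le> 1 / \<epsilon>" using \<epsilon> by (simp add: field_simps)
      then have "log 2 2 \<le> log 2 (1 / \<epsilon>)" using \<epsilon> by (subst log_le_cancel_iff) auto
      then show ?thesis by (simp add: l_def)
    qed
    have ln\<epsilon>: "ln (1 / \<epsilon>) = l * ln 2" by (simp add: l_def log_def)
    have two_l: "2 powr l = 1 / \<epsilon>" using \<epsilon> by (simp add: l_def)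
    define n where "n = nat \<lceil>l + 2\<rceil>"
    have n: "l + 2 \<le> real n" "real n \<le> l + 3" using l unfolding n_def by linarith+
    have pn: "2 ^ n = 2 powr real n" by (simp add: powr_realpow)
    have "4 / \<epsilon> = 2 powr (l + 2)" using two_l by (simp add: powr_add)
    also have "\<dots> \<le> 2 ^ n" unfolding pn using n by simp
    finally have 1: "2 * (2 / 2 ^ n) \<le> \<epsilon>" using \<epsilon> by (simp add: field_simps)
    have "real n + 1 \<le> 5 * l" using n l by linarith
    also have "\<dots> = c * ln (1 / \<epsilon>)" unfolding ln\<epsilon> c_def by simp
    finally have 2: "real n + 1 \<le> c * ln (1 / \<epsilon>)" .
    have lpos: "0 \<le> ln (1 / \<epsilon>)" unfolding ln\<epsilon> using l by simp
    have 3: "2 powr (a * real n) \<le> 8 powr a * \<epsilon> powr (- a)"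
    proof -
      have "2 powr (a * real n) \<le> 2 powr (a * (l + 3))" using n a by simp
      also have "\<dots> = (2 powr (l + 3)) powr a" by (simp add: powr_powr mult.commute)
      also have "2 powr (l + 3) = 8 * (1 / \<epsilon>)" using two_l by (simp add: powr_add)
      also have "(8 * (1 / \<epsilon>)) powr a = 8 powr a * (1 / \<epsilon>) powr a" by (rule powr_mult)
      also have "(1 / \<epsilon>) powr a = \<epsilon> powr (- a)" using \<epsilon> by (simp add: powr_divide powr_minus_divide)
      finally show ?thesis .
    qed
    have "(real n + 1) ^ d * ((real n + 1) powr (a / 2) * 2 powr (a * real n))
        \<le> (c * ln (1 / \<epsilon>)) ^ d * ((c * ln (1 / \<epsilon>)) powr (a / 2) * (8 powr a * \<epsilon> powr (- a)))"
      using 2 3 a c lpos by (intro mult_mono power_mono powr_mono2) auto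
    also have "\<dots> = C * (\<epsilon> powr (- a) * ln (1 / \<epsilon>) ^ d * ln (1 / \<epsilon>) powr (a / 2))"
      unfolding C_def power_mult_distrib using c lpos by (simp add: powr_mult mult_ac)
    finally show ?thesis using 1 by blast
  qed
  ultimately show ?thesis by blast
qed

section \<open>Entropy of the absolutely convex hull\<close>

theorem theorem5p2:
  fixes d q :: nat
    and \<mu> :: "real measure"
    and \<psi> :: "real \<Rightarrow> real \<Rightarrow> real"
    and V \<gamma> W :: real
    and \<V> :: "nat \<Rightarrow> (real \<Rightarrow> real) set"
  assumes "d \<ge> 1"
    and "sets \<mu> = sets borel"
    and "sigma_finite_measure \<mu>"
    and "\<And>v. v \<in> {0..1} \<Longrightarrow> \<psi> v \<in> L2_fun \<mu>"
    and "\<And>v. v \<in> {0..1} \<Longrightarrow> L2_seminorm \<mu> (\<psi> v) \<le> 1"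
    and "V > 0"
    and "lesssim (\<lambda>\<epsilon>. ereal_of_enat (covering_number (L2_fun \<mu>) (L2_dist \<mu>) \<epsilon> (\<psi> ` {0..1})))
           (\<lambda>\<epsilon>. \<epsilon> powr (- V))"
    and "q \<ge> 1" and "\<gamma> > 0" and "W > 0"
    and "nested_approximations \<mu> \<psi> q \<gamma> W \<V>"
  shows "lesssim (\<lambda>\<epsilon>. metric_entropy (L2_fun (product_power \<mu> d)) (L2_dist (product_power \<mu> d)) \<epsilon>
                (absconv_tensor \<mu> d \<psi>))
           (\<lambda>\<epsilon>. \<epsilon> powr (- (2 * W / (2 + W))) * ln (1 / \<epsilon>) ^ (d - 1)
                    * ln (1 / \<epsilon>) powr (W / (2 + W)))"
proof -
  note \<mu> = assms(3) and \<psi> = assms(4) and \<psi>1 = assms(5)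
  define d' where "d' = d - 1"
  have d: "d = Suc d'" using assms(1) by (simp add: d'_def)
  let ?P = "product_power \<mu> d"
  define a where "a = 2 * W / (2 + W)"
  have a: "a > 0" using assms(10) by (simp add: a_def)
  define \<rho> where "\<rho> = 2 powr (- 2 / W)"
  have \<rho>: "0 < \<rho>" "\<rho> \<le> 1"
    using assms(10) powr_mono[of "- 2 / W" 0 2] by (simp_all add: \<rho>_def)
  define G where "G = max 1 (\<gamma>\<^sup>2)"
  have G: "1 \<le> G" by (simp add: G_def)
  define J where "J = PiE {..<d} (\<lambda>_. {0..1 :: real})"
  define g where "g = (\<lambda>v. tensor d (\<lambda>l. \<psi> (v l)))"
  have J: "v l \<in> {0..1}" if "v \<in> J" "l < d" for v l
    using that unfolding J_def by (auto dest!: PiE_mem)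
  have gL: "g v \<in> L2_fun ?P" if v: "v \<in> J" for v
    unfolding g_def by (intro tensor_L2[OF \<mu>] \<psi> J[OF v])
  have g1: "L2_seminorm ?P (g v) \<le> 1" if v: "v \<in> J" for v
  proof -
    have "L2_seminorm ?P (g v) = (\<Prod>l<d. L2_seminorm \<mu> (\<psi> (v l)))"
      unfolding g_def by (intro L2_seminorm_tensor[OF \<mu>] \<psi> J[OF v])
    also have "\<dots> \<le> 1"
    proof (intro prod_le_1 conjI L2_seminorm_nonneg)
      fix l assume "l \<in> {..<d}"
      then show "L2_seminorm \<mu> (\<psi> (v l)) \<le> 1" by (intro \<psi>1 J[OF v]) simp
    qed
    finally show ?thesis .
  qed
  have "\<exists>(e :: nat \<Rightarrow> real \<Rightarrow> real) lev. orthosys \<mu> UNIV e \<and>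
    (\<forall>k. finite {n. lev n \<le> k} \<and> real (card {n. lev n \<le> k}) \<le> 2 * real q * 2 ^ k) \<and>
    (\<forall>k. \<forall>v\<in>{0..1}. (L2_seminorm \<mu> (residual \<mu> {n. lev n \<le> k} e (\<psi> v)))\<^sup>2 \<le> G * \<rho> ^ k)"
    unfolding G_def \<rho>_def by (rule nested_approximations_orthosys[OF assms(8,9,10) \<psi> \<psi>1 assms(11)])
  then obtain e :: "nat \<Rightarrow> real \<Rightarrow> real" and lev where os: "orthosys \<mu> UNIV e"
    and lev: "\<forall>k. finite {n. lev n \<le> k} \<and> real (card {n. lev n \<le> k}) \<le> 2 * real q * 2 ^ k"
    and tail: "\<forall>k. \<forall>v\<in>{0..1}. (L2_seminorm \<mu> (residual \<mu> {n. lev n \<le> k} e (\<psi> v)))\<^sup>2 \<le> G * \<rho> ^ k"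
    by (elim exE conjE)
  have fin: "finite {n. lev n \<le> k}" and cardlev: "real (card {n. lev n \<le> k}) \<le> 2 * real q * 2 ^ k" for k
    using lev by simp_all
  define E where "E = (\<lambda>i. tensor d (\<lambda>l. e (i l)))"
  define I where "I = sparse lev d"
  have osE: "orthosys ?P (I k) E" for k
    unfolding E_def I_def by (intro orthosys_tensor[OF \<mu> os]) (auto simp: sparse_def)
  have finI: "finite (I k)" for k unfolding I_def by (rule finite_sparse[OF fin])
  define A where "A = (2 * real q) ^ d"
  have A: "0 \<le> A" by (simp add: A_def)
  have cardI: "real (card (I k)) \<le> A * (real k + 1) ^ d' * 2 ^ k" for k
    unfolding A_def I_def d using assms(8) by (intro card_sparse_le fin cardlev) auto
  define S where "S = (2 * G / \<rho>) ^ d"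
  have S: "0 \<le> S" using G \<rho> by (simp add: S_def)
  define sg where "sg = (\<lambda>k. sqrt (S * (real k + 1) ^ d' * \<rho> ^ k))"
  have sg: "0 \<le> sg k" for k using S \<rho> by (simp add: sg_def)
  have sg2: "(sg k)\<^sup>2 = S * (real k + 1) ^ d' * \<rho> ^ k" for k using S \<rho> by (simp add: sg_def)
  have res: "L2_seminorm ?P (residual ?P (I k) E (g v)) \<le> sg k" if v: "v \<in> J" for v k
  proof -
    \<comment> \<open>\<open>residual_tensor\<close> wants a factor for every natural number; those beyond \<open>d\<close> are dummies.\<close>
    define f where "f = (\<lambda>l. \<psi> (if l < d then v l else 0))"
    have arg: "(if l < d then v l else 0) \<in> {0..1}" for l
    proof (cases "l < d")
      case True
      then show ?thesis using J[OF v True] by (simp only: if_True)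
    qed simp
    have tl: "(L2_seminorm \<mu> (residual \<mu> {n. lev n \<le> k} e (f l)))\<^sup>2 \<le> G * \<rho> ^ k" for l k
      unfolding f_def by (rule tail[THEN spec, THEN bspec, OF arg])
    have "g v = tensor d f"
      unfolding g_def by (rule tensor_cong) (simp add: f_def)
    then have "(L2_seminorm ?P (residual ?P (I k) E (g v)))\<^sup>2 \<le> S * (real k + 1) ^ d' * \<rho> ^ k"
      using residual_tensor[of \<mu> e lev G \<rho> f d' k, OF \<mu> os fin G \<rho> _ _ tl] \<psi>[OF arg] \<psi>1[OF arg]
      unfolding E_def I_def S_def d f_def by simp
    then show ?thesis
      unfolding sg_def by (rule real_le_rsqrt)
  qed
  have "\<exists>C>0. \<forall>n. \<exists>J0. finite J0 \<and> J0 \<subseteq> J \<and>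
    (\<forall>a\<in>J. \<exists>b\<in>J0. L2_dist ?P (g a) (g b) \<le> (2 / 2 ^ n) / 16) \<and>
    ln (2 * real (card J0) + 1) \<le> C * (real n + 1)"
    unfolding J_def g_def by (rule tensor_net[OF \<mu> assms(1,6) \<psi> \<psi>1 assms(7)])
  then obtain C where C: "C > 0" and net: "\<forall>n. \<exists>J0. finite J0 \<and> J0 \<subseteq> J \<and>
    (\<forall>a\<in>J. \<exists>b\<in>J0. L2_dist ?P (g a) (g b) \<le> (2 / 2 ^ n) / 16) \<and>
    ln (2 * real (card J0) + 1) \<le> C * (real n + 1)"
    by (elim exE conjE)
  define h where "h = (\<lambda>n::nat. (real n + 1) ^ d' * ((real n + 1) powr (a / 2) * 2 powr (a * real n)))"
  have h0: "0 \<le> h n" for n by (simp add: h_def)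
  obtain K where K: "K \<ge> 0" and bal: "\<forall>n. \<exists>k.
      18 * (A * (real k + 1) ^ d' * 2 ^ k + 1) * ln 2
        + (16 * 4 ^ n * (S * (real k + 1) ^ d' * \<rho> ^ k) + 2) * (C * (real n + 1)) \<le> K * h n"
    using balance_levels[OF assms(10) A S less_imp_le[OF C], of d']
    unfolding h_def a_def \<rho>_def by (elim exE conjE)
  \<comment> \<open>Induction over the scales, starting from one ball of radius \<open>2\<close>, which contains the hull.\<close>
  have cov: "coverable ?P (2 / 2 ^ n) (abs_hull J g) (exp (\<Sum>i<n. K * h i))" for n
  proof (induction n)
    case 0
    then show ?case using coverable_abs_hull_2[of J g ?P] gL g1 by simp
  next
    case (Suc n)
    define r where "r = 2 / (2 :: real) ^ n"
    have r: "r > 0" by (simp add: r_def)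
    obtain k where k: "18 * (A * (real k + 1) ^ d' * 2 ^ k + 1) * ln 2
        + (16 * 4 ^ n * (S * (real k + 1) ^ d' * \<rho> ^ k) + 2) * (C * (real n + 1)) \<le> K * h n"
      using bal by blast
    obtain J0 where J0: "finite J0" "J0 \<subseteq> J"
      "\<forall>a\<in>J. \<exists>b\<in>J0. L2_dist ?P (g a) (g b) \<le> (2 / 2 ^ n) / 16"
      "ln (2 * real (card J0) + 1) \<le> C * (real n + 1)"
      using net[THEN spec, of n] by (elim exE conjE)
    define y where "y = (8 * sg k / r)\<^sup>2"
    \<comment> \<open>The summand \<open>1\<close> ensures \<open>m \<ge> 1\<close> even if the residuals vanish.\<close>
    define m where "m = nat \<lceil>y\<rceil> + 1"
    have y: "0 \<le> y" by (simp add: y_def)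
    have m: "m \<ge> 1" "y \<le> real m" "real m \<le> y + 2"
      using y unfolding m_def by linarith+
    have y_eq: "y = 16 * 4 ^ n * (S * (real k + 1) ^ d' * \<rho> ^ k)"
    proof -
      have "((2 :: real) ^ n)\<^sup>2 = 4 ^ n" by (simp add: power2_eq_square flip: power_mult_distrib)
      then show ?thesis
        unfolding y_def r_def power_divide power_mult_distrib sg2 by simp
    qed
    have sgm: "sg k \<le> r / 8 * sqrt (real m)"
    proof -
      have "8 * sg k / r = sqrt y" using sg r unfolding y_def by simp
      also have "\<dots> \<le> sqrt (real m)" using m by simp
      finally show ?thesis using r by (simp add: field_simps)
    qed
    have near: "\<exists>b\<in>J0. L2_dist ?P (g v) (g b) \<le> r / 16" if "v \<in> J" for v
      using J0(3) that unfolding r_def by blast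
    have "coverable ?P (r / 2) (abs_hull J g)
      (exp (\<Sum>i<n. K * h i) * (2 ^ (18 * (card (I k) + 1)) * (2 * real (card J0) + 1) ^ m))"
      by (rule coverable_halve[OF gL J0(1,2) near osE finI res sg m(1) sgm r Suc.IH[folded r_def]])
    moreover have "exp (\<Sum>i<n. K * h i) * (2 ^ (18 * (card (I k) + 1)) * (2 * real (card J0) + 1) ^ m)
        \<le> exp (\<Sum>i<Suc n. K * h i)"
    proof -
      have ln0: "0 \<le> ln (2 * real (card J0) + 1)" by simp
      have "2 ^ (18 * (card (I k) + 1)) * (2 * real (card J0) + 1) ^ m
          = exp (real (18 * (card (I k) + 1)) * ln 2 + real m * ln (2 * real (card J0) + 1))"
        by (simp only: exp_add exp_of_nat_mult) (simp add: add_nonneg_pos)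
      also have "real (18 * (card (I k) + 1)) * ln 2 + real m * ln (2 * real (card J0) + 1) \<le> K * h n"
      proof -
        have "real (18 * (card (I k) + 1)) * ln 2 \<le> 18 * (A * (real k + 1) ^ d' * 2 ^ k + 1) * ln 2"
          using cardI[of k] by (intro mult_right_mono) auto
        moreover have "real m * ln (2 * real (card J0) + 1)
            \<le> (16 * 4 ^ n * (S * (real k + 1) ^ d' * \<rho> ^ k) + 2) * (C * (real n + 1))"
          using m(3) y y_eq J0(4) ln0 by (intro mult_mono) auto
        ultimately show ?thesis using k by linarith
      qed
      finally have "2 ^ (18 * (card (I k) + 1)) * (2 * real (card J0) + 1) ^ m \<le> exp (K * h n)"
        by simp
      then show ?thesis by (simp add: exp_add)
    qed
    ultimately have "coverable ?P (r / 2) (abs_hull J g) (exp (\<Sum>i<Suc n. K * h i))"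
      by (rule coverable_subset[OF _ subset_refl])
    then show ?case by (simp add: r_def mult.commute)
  qed
  define K' where "K' = K / (2 powr a - 1)"
  have b1: "0 < 2 powr a - 1" using a by simp
  have K': "0 \<le> K'" using K b1 by (simp add: K'_def)
  have sumK: "(\<Sum>i<n. K * h i) \<le> K' * h n" for n
  proof -
    have "(\<Sum>i<n. h i) \<le> h n / (2 powr a - 1)"
      unfolding h_def by (rule sum_entropy_increments[OF a])
    then have "K * (\<Sum>i<n. h i) \<le> K * (h n / (2 powr a - 1))" using K by (intro mult_left_mono)
    then show ?thesis by (simp add: K'_def sum_distrib_left)
  qed
  have sub: "absconv_tensor_combs d \<psi> \<subseteq> abs_hull J g"
    unfolding J_def g_def by (rule absconv_tensor_combs_subset)
  have sub2: "absconv_tensor_combs d \<psi> \<subseteq> L2_fun ?P"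
    by (rule subset_trans[OF sub abs_hull_L2]) (rule gL)
  have entropy: "metric_entropy (L2_fun ?P) (L2_dist ?P) \<epsilon> (absconv_tensor \<mu> d \<psi>) \<le> ereal (K' * h n)"
    if "2 * (2 / 2 ^ n) \<le> \<epsilon>" for n \<epsilon>
  proof -
    have "coverable ?P (2 / 2 ^ n) (absconv_tensor_combs d \<psi>) (exp (K' * h n))"
      using coverable_subset[OF cov sub, of n "exp (K' * h n)"] sumK by simp
    moreover have "1 \<le> exp (K' * h n)" using K' h0 by simp
    ultimately have "metric_entropy (L2_fun ?P) (L2_dist ?P) \<epsilon> (absconv_tensor \<mu> d \<psi>) \<le> ereal (ln (exp (K' * h n)))"
      unfolding absconv_tensor_def using that by (intro metric_entropy_closure_le sub2) auto
    then show ?thesis by simp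
  qed
  obtain Q where Q: "Q > 0" and scale: "\<forall>\<epsilon>. 0 < \<epsilon> \<and> \<epsilon> \<le> 1 / 2 \<longrightarrow> (\<exists>n. 2 * (2 / 2 ^ n) \<le> \<epsilon> \<and>
     h n \<le> Q * (\<epsilon> powr (- a) * ln (1 / \<epsilon>) ^ d' * ln (1 / \<epsilon>) powr (a / 2)))"
    using dyadic_scale[OF a, of d'] unfolding h_def by (elim exE conjE)
  let ?g = "\<lambda>\<epsilon>. \<epsilon> powr (- a) * ln (1 / \<epsilon>) ^ d' * ln (1 / \<epsilon>) powr (a / 2)"
  have bound: "metric_entropy (L2_fun ?P) (L2_dist ?P) \<epsilon> (absconv_tensor \<mu> d \<psi>) / ereal (?g \<epsilon>) \<le> ereal (K' * Q)"
    if \<epsilon>: "0 < \<epsilon>" "\<epsilon> < 1 / 2" for \<epsilon>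
  proof -
    obtain n where n: "2 * (2 / 2 ^ n) \<le> \<epsilon>" "h n \<le> Q * ?g \<epsilon>"
      using scale[THEN spec, THEN mp, OF conjI[OF \<epsilon>(1) less_imp_le[OF \<epsilon>(2)]]] by (elim exE conjE)
    have "1 < 1 / \<epsilon>" using \<epsilon> by simp
    then have "0 < ln (1 / \<epsilon>)" by (rule ln_gt_zero)
    then have pos: "0 < ?g \<epsilon>" using \<epsilon> by simp
    have "K' * h n \<le> ?g \<epsilon> * (K' * Q)"
      using mult_left_mono[OF n(2) K'] by (simp add: mult_ac)
    then have "metric_entropy (L2_fun ?P) (L2_dist ?P) \<epsilon> (absconv_tensor \<mu> d \<psi>) \<le> ereal (?g \<epsilon>) * ereal (K' * Q)"
      using order_trans[OF entropy[OF n(1)]] by simp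
    then show ?thesis using pos ereal_divide_le_pos[of "ereal (?g \<epsilon>)"] by simp
  qed
  have "eventually (\<lambda>\<epsilon>. metric_entropy (L2_fun ?P) (L2_dist ?P) \<epsilon> (absconv_tensor \<mu> d \<psi>) / ereal (?g \<epsilon>)
      \<le> ereal (K' * Q)) (at_right 0)"
    unfolding eventually_at_right_field by (intro exI[of _ "1 / 2"] conjI allI impI bound) simp_all
  then have "Limsup (at_right 0) (\<lambda>\<epsilon>. metric_entropy (L2_fun ?P) (L2_dist ?P) \<epsilon> (absconv_tensor \<mu> d \<psi>) / ereal (?g \<epsilon>))
      \<le> ereal (K' * Q)"
    by (rule Limsup_bounded)
  also have "\<dots> < \<infinity>" by simp
  finally have lesssim: "lesssim (\<lambda>\<epsilon>. metric_entropy (L2_fun ?P) (L2_dist ?P) \<epsilon> (absconv_tensor \<mu> d \<psi>)) ?g"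
    unfolding lesssim_def .
  have "a = W / (2 + W) + W / (2 + W)"
    unfolding a_def mult_2 add_divide_distrib by (rule refl)
  then have half: "a / 2 = W / (2 + W)" by linarith
  show ?thesis
    using lesssim unfolding half d'_def unfolding a_def .
qed

end
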